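(* Let $V^{[*]}$ be a dg vertex operator algebra. The algebra $\operatorname{gr}_*\operatorname{gr}^{[*]}A(V^{[*]})\cong\operatorname{gr}^{[*]}\operatorname{gr}_*A(V^{[*]})$ is a weight graded dg Poisson algebra. The Poisson bracket is of degree $-2$ for the cohomological degree, and of degree $-1$ for the weight. Furthermore, the dg grading makes it a graded commutative algebra.
   Context: All vector spaces are over $\mathbb C$. A (cochain) complex $V^{[*]}=\bigoplus_{p\in\mathbb Z}V^{[p]}$ has a differential $d_V$ of degree $+1$ with $d_V^2=0$; $|v|=p$ for $v\in V^{[p]}$. $\operatorname{End}^{[*]}(V^{[*]})=\bigoplus_p\operatorname{End}^{[p]}(V^{[*]})$, where $\operatorname{End}^{[p]}$ is the space of linear maps of degree $p$. A dg vertex algebra $(V^{[*]},d_V,Y(\cdot,x),\mathbf 1)$ is a complex with a linear map $v\mapsto Y(v,x)=\sum_{n\in\mathbb Z}v_nx^{-n-1}\in\operatorname{End}^{[*]}(V^{[*]})[[x,x^{-1}]]$ such that for $v\in V^{[p]}$ one has $v_n\in\operatorname{End}^{[p-2n-2]}(V^{[*]})$ and $(d_Vv)_n=d_V\circ v_n-(-1)^{p}v_n\circ d_V$, and a vector $\mathbf 1\in V^{[0]}$ with $d_V\mathbf 1=0$, such that: $u_nv=0$ for $n$ sufficiently large; $Y(\mathbf 1,x)=\operatorname{id}$; $Y(v,x)\mathbf 1\in V^{[*]}[[x]]$ with constant term $v$; and (Jacobi identity) for homogeneous $u,v$ and all $l,m,n\in\mathbb Z$, $$\sum_{i\ge0}(-1)^i\binom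 li\left(u_{m+l-i}v_{n+i}-(-1)^{l}(-1)^{|u||v|}v_{n+l-i}u_{m+i}\right)=\sum_{i\ge0}\binom mi(u_{l+i}v)_{m+n-i}.$$ A dg vertex operator algebra is a dg vertex algebra with $\omega\in V^{[4]}$, $d_V\omega=0$, such that, writing $Y(\omega,x)=\sum_nL(n)x^{-n-2}$: $[L(m),L(n)]=(m-n)L(m+n)+\frac1{12}(m^3-m)\delta_{m+n,0}c_V$ for some $c_V\in\mathbb C$; $L(0)$ is semisimple with $V^{[*]}=\bigoplus_{n\in\frac12\mathbb Z}V_n^{[*]}$, $V_n^{[*]}$ the eigenspace of eigenvalue (weight) $n$, $\omega\in V_2^{[*]}$, $\dim V_n^{[*]}<\infty$, $V_n^{[*]}=0$ for $n\ll0$; and $L(-1)v=v_{-2}\mathbf 1$. Put $V_n^{[p]}=V_n^{[*]}\cap V^{[p]}$ and $\operatorname{wt}(u)=n$ for $u\in V_n^{[*]}$. Zhu algebra: for $u$ weight homogeneous (extended linearly in $u$), $u\ast v=\sum_{n\ge0}\binom{\operatorname{wt}(u)}{n}u_{n-1}v$ and $u\circ v=\sum_{n\ge0}\binom{\operatorname{wt}(u)}{n}u_{n-2}v$. $O(V^{[*]})$ is the span of all $u\circ v$, and $A(V^{[*]})=V^{[*]}/O(V^{[*]})$, an associative algebra under $\ast$, filtered by cohomological degree ($F^p$ = image of $\bigoplus_{q\le p}V^{[q]}$) and by weight ($W_n$ = image of $\bigoplus_{m\le n}V_m^{[*]}$). The associated bigraded algebra for the two filtrations, denoted $\operatorname{gr}_*\operatorname{gr}^{[*]}A(V^{[*]})\cong\operatorname{gr}^{[*]}\operatorname{gr}_*A(V^{[*]})$,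 is $$\bigoplus_{p\in\mathbb Z}\bigoplus_{n\in\frac12\mathbb Z}\left(V_n^{[p]}\bmod I_n^{[p]}\right),\qquad I_n^{[p]}=O(V^{[*]})+\bigoplus_{q\le p,\,m<n}V_m^{[q]}+\bigoplus_{q<p,\,m\le n}V_m^{[q]},$$ where $V_n^{[p]}\bmod I_n^{[p]}$ is the image of $V_n^{[p]}$ in $V^{[*]}/I_n^{[p]}$. The product is induced by $\ast$, the differential by $d_V$, and the bracket of the classes of $u\in V_{n_1}^{[p_1]}$, $v\in V_{n_2}^{[p_2]}$ is the class of $u\ast v-(-1)^{p_1p_2}v\ast u$ modulo $I_{n_1+n_2-1}^{[p_1+p_2-2]}$, in bidegree $(p_1+p_2-2,n_1+n_2-1)$. A dg Poisson algebra with bracket of even degree $k$ is an associative dg algebra $(R^{[*]},d)$ with a bracket $R^{[p]}\times R^{[q]}\to R^{[p+q+k]}$ such that for homogeneous $a,b,c$: $\{a,b\}=-(-1)^{|a||b|}\{b,a\}$; $\{a,\{b,c\}\}=\{\{a,b\},c\}+(-1)^{|a||b|}\{b,\{a,c\}\}$; $\{a,bc\}=\{a,b\}c+(-1)^{|a||b|}b\{a,c\}$; $d\{a,b\}=\{da,b\}+(-1)^{|a|}\{a,db\}$. Weight graded: with an additional $\frac12\mathbb Z$-grading by subcomplexes, additive under the product, for which the bracket is homogeneous. Graded commutative: $ab=(-1)^{|a||b|}ba$. *)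

theory Defs
  imports
    Complex_Main
    "HOL-Library.FuncSet"
    "HOL-Library.Groups_Big_Fun"
    "HOL-Library.Set_Algebras"
    "HOL-Algebra.Module"
begin

definition half_ints :: "real set"
  where "half_ints = {n. 2 * n \<in> \<int>}"

section \<open>Direct sums of subspaces\<close>

text \<open>A vertex algebra lives on a whole type, with the operations of its type class. The algebra
  built from it consists of families of cosets and is a structure with a carrier in the style of
  HOL-Algebra. Direct sums are needed in both settings.\<close>

definition decomposes :: "'i set \<Rightarrow> ('i \<Rightarrow> 'v::comm_monoid_add set) \<Rightarrow> 'v \<Rightarrow> ('i \<Rightarrow> 'v) \<Rightarrow> bool"
  where "decomposes I W v f \<longleftrightarrow>
    f \<in> (\<Pi>\<^sub>E i\<in>I. W i) \<and> finite {i \<in> I. f i \<noteq> 0} \<and> v = (\<Sum>i\<in>{i \<in> I. f i \<noteq> 0}. f i)"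

definition direct_sum :: "'i set \<Rightarrow> ('i \<Rightarrow> 'v::comm_monoid_add set) \<Rightarrow> bool"
  where "direct_sum I W \<longleftrightarrow> (\<forall>v. \<exists>!f. decomposes I W v f)"

definition homogeneous_part :: "'i set \<Rightarrow> ('i \<Rightarrow> 'v::comm_monoid_add set) \<Rightarrow> 'i \<Rightarrow> 'v \<Rightarrow> 'v"
  where "homogeneous_part I W i v = (THE f. decomposes I W v f) i"

definition carrier_direct_sum ::
    "('a, 'm) ring_scheme \<Rightarrow> 'a set \<Rightarrow> 'i set \<Rightarrow> ('i \<Rightarrow> 'a set) \<Rightarrow> bool"
  where "carrier_direct_sum R M I W \<longleftrightarrow>
    (\<forall>i\<in>I. W i \<subseteq> M) \<and>
    (\<forall>x\<in>M. \<exists>!f. f \<in> (\<Pi>\<^sub>E i\<in>I. W i) \<and> finite {i \<in> I. f i \<noteq> \<zero>\<^bsub>R\<^esub>} \<and>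
      x = (\<Oplus>\<^bsub>R\<^esub>i\<in>{i \<in> I. f i \<noteq> \<zero>\<^bsub>R\<^esub>}. f i))"

section \<open>Weight graded dg Poisson algebras\<close>

definition complex_field :: "complex ring"
  where "complex_field =
    \<lparr>carrier = UNIV, monoid.mult = (*), one = 1, ring.zero = 0, add = (+)\<rparr>"

text \<open>The library locale \<open>algebra\<close> is restricted to commutative rings.\<close>

locale complex_algebra = ring R + Module.module complex_field R
  for R :: "(complex, 'a, 'm) module_scheme" (structure) +
  assumes smult_mult_left:
      "\<lbrakk>a \<in> carrier R; b \<in> carrier R\<rbrakk> \<Longrightarrow> (z \<odot> a) \<otimes> b = z \<odot> (a \<otimes> b)"
    and smult_mult_right:
      "\<lbrakk>a \<in> carrier R; b \<in> carrier R\<rbrakk> \<Longrightarrow> a \<otimes> (z \<odot> b) = z \<odot> (a \<otimes> b)"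

locale dg_algebra = complex_algebra R
  for R :: "(complex, 'a, 'm) module_scheme" (structure) +
  fixes deg :: "int \<Rightarrow> 'a set"
    and d :: "'a \<Rightarrow> 'a"
  assumes deg_submodule: "submodule (deg p) complex_field R"
    and deg_direct_sum: "carrier_direct_sum R (carrier R) UNIV deg"
    and deg_one: "\<one> \<in> deg 0"
    and deg_mult: "\<lbrakk>a \<in> deg p; b \<in> deg q\<rbrakk> \<Longrightarrow> a \<otimes> b \<in> deg (p + q)"
    and d_closed: "a \<in> carrier R \<Longrightarrow> d a \<in> carrier R"
    and d_add: "\<lbrakk>a \<in> carrier R; b \<in> carrier R\<rbrakk> \<Longrightarrow> d (a \<oplus> b) = d a \<oplus> d b"
    and d_smult: "a \<in> carrier R \<Longrightarrow> d (z \<odot> a) = z \<odot> d a"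
    and d_deg: "a \<in> deg p \<Longrightarrow> d a \<in> deg (p + 1)"
    and d_d: "a \<in> carrier R \<Longrightarrow> d (d a) = \<zero>"
    and d_mult: "\<lbrakk>a \<in> deg p; b \<in> deg q\<rbrakk> \<Longrightarrow>
      d (a \<otimes> b) = d a \<otimes> b \<oplus> ((-1) powi p) \<odot> (a \<otimes> d b)"

locale dg_poisson_algebra = dg_algebra R deg d
  for R :: "(complex, 'a, 'm) module_scheme" (structure)
    and deg :: "int \<Rightarrow> 'a set"
    and d :: "'a \<Rightarrow> 'a" +
  fixes bracket :: "'a \<Rightarrow> 'a \<Rightarrow> 'a"  (\<open>\<lbrace>_,/ _\<rbrace>\<close>)
    and k :: int
  assumes even_k: "even k"
    and bracket_closed: "\<lbrakk>a \<in> carrier R; b \<in> carrier R\<rbrakk> \<Longrightarrow> \<lbrace>a, b\<rbrace> \<in> carrier R"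
    and bracket_add_left:
      "\<lbrakk>a \<in> carrier R; b \<in> carrier R; c \<in> carrier R\<rbrakk> \<Longrightarrow> \<lbrace>a \<oplus> b, c\<rbrace> = \<lbrace>a, c\<rbrace> \<oplus> \<lbrace>b, c\<rbrace>"
    and bracket_add_right:
      "\<lbrakk>a \<in> carrier R; b \<in> carrier R; c \<in> carrier R\<rbrakk> \<Longrightarrow> \<lbrace>a, b \<oplus> c\<rbrace> = \<lbrace>a, b\<rbrace> \<oplus> \<lbrace>a, c\<rbrace>"
    and bracket_smult_left:
      "\<lbrakk>a \<in> carrier R; b \<in> carrier R\<rbrakk> \<Longrightarrow> \<lbrace>z \<odot> a, b\<rbrace> = z \<odot> \<lbrace>a, b\<rbrace>"
    and bracket_smult_right:
      "\<lbrakk>a \<in> carrier R; b \<in> carrier R\<rbrakk> \<Longrightarrow> \<lbrace>a, z \<odot> b\<rbrace> = z \<odot> \<lbrace>a, b\<rbrace>"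
    and bracket_deg: "\<lbrakk>a \<in> deg p; b \<in> deg q\<rbrakk> \<Longrightarrow> \<lbrace>a, b\<rbrace> \<in> deg (p + q + k)"
    and bracket_antisym: "\<lbrakk>a \<in> deg p; b \<in> deg q\<rbrakk> \<Longrightarrow>
      \<lbrace>a, b\<rbrace> = \<ominus> (((-1) powi (p * q)) \<odot> \<lbrace>b, a\<rbrace>)"
    and bracket_jacobi: "\<lbrakk>a \<in> deg p; b \<in> deg q; c \<in> deg r\<rbrakk> \<Longrightarrow>
      \<lbrace>a, \<lbrace>b, c\<rbrace>\<rbrace> = \<lbrace>\<lbrace>a, b\<rbrace>, c\<rbrace> \<oplus> ((-1) powi (p * q)) \<odot> \<lbrace>b, \<lbrace>a, c\<rbrace>\<rbrace>"
    and bracket_leibniz: "\<lbrakk>a \<in> deg p; b \<in> deg q; c \<in> deg r\<rbrakk> \<Longrightarrow>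
      \<lbrace>a, b \<otimes> c\<rbrace> = \<lbrace>a, b\<rbrace> \<otimes> c \<oplus> ((-1) powi (p * q)) \<odot> (b \<otimes> \<lbrace>a, c\<rbrace>)"
    and d_bracket: "\<lbrakk>a \<in> deg p; b \<in> deg q\<rbrakk> \<Longrightarrow>
      d \<lbrace>a, b\<rbrace> = \<lbrace>d a, b\<rbrace> \<oplus> ((-1) powi p) \<odot> \<lbrace>a, d b\<rbrace>"

text \<open>The parameter \<open>w\<close> is the degree of the bracket with respect to the weight.\<close>

locale weight_graded_dg_poisson_algebra = dg_poisson_algebra R deg d bracket k
  for R :: "(complex, 'a, 'm) module_scheme" (structure)
    and deg :: "int \<Rightarrow> 'a set"
    and d :: "'a \<Rightarrow> 'a"
    and bracket :: "'a \<Rightarrow> 'a \<Rightarrow> 'a"  (\<open>\<lbrace>_,/ _\<rbrace>\<close>)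
    and k :: int +
  fixes weight :: "real \<Rightarrow> 'a set"
    and w :: real
  assumes w_half_int: "w \<in> half_ints"
    and weight_submodule: "n \<in> half_ints \<Longrightarrow> submodule (weight n) complex_field R"
    and weight_direct_sum: "carrier_direct_sum R (carrier R) half_ints weight"
    and weight_graded:
      "n \<in> half_ints \<Longrightarrow> carrier_direct_sum R (weight n) UNIV (\<lambda>p. weight n \<inter> deg p)"
    and weight_d: "\<lbrakk>n \<in> half_ints; a \<in> weight n\<rbrakk> \<Longrightarrow> d a \<in> weight n"
    and weight_one: "\<one> \<in> weight 0"
    and weight_mult: "\<lbrakk>m \<in> half_ints; n \<in> half_ints; a \<in> weight m; b \<in> weight n\<rbrakk> \<Longrightarrow>
      a \<otimes> b \<in> weight (m + n)"
    and weight_bracket: "\<lbrakk>m \<in> half_ints; n \<in> half_ints; a \<in> weight m; b \<in> weight n\<rbrakk> \<Longrightarrow>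
      \<lbrace>a, b\<rbrace> \<in> weight (m + n + w)"

definition graded_commutative :: "(complex, 'a, 'm) module_scheme \<Rightarrow> (int \<Rightarrow> 'a set) \<Rightarrow> bool"
  where "graded_commutative R deg \<longleftrightarrow>
    (\<forall>p q. \<forall>a\<in>deg p. \<forall>b\<in>deg q. a \<otimes>\<^bsub>R\<^esub> b = ((-1) powi (p * q)) \<odot>\<^bsub>R\<^esub> (b \<otimes>\<^bsub>R\<^esub> a))"

section \<open>Dg vertex operator algebras\<close>

locale cochain_complex = vector_space scale
  for scale :: "complex \<Rightarrow> 'v::ab_group_add \<Rightarrow> 'v"  (infixr \<open>*\<^sub>C\<close> 75) +
  fixes V :: "int \<Rightarrow> 'v set"
    and d :: "'v \<Rightarrow> 'v"
  assumes V_subspace: "subspace (V p)"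
    and V_direct_sum: "direct_sum UNIV V"
    and d_linear: "Vector_Spaces.linear scale scale d"
    and d_deg: "v \<in> V p \<Longrightarrow> d v \<in> V (p + 1)"
    and d_d: "d (d v) = 0"

text \<open>\<open>Y u n v\<close> is \<open>u\<^sub>n v\<close>. The two sums in the Jacobi identity have finite support by truncation.\<close>

locale dg_vertex_algebra = cochain_complex scale V d
  for scale :: "complex \<Rightarrow> 'v::ab_group_add \<Rightarrow> 'v"  (infixr \<open>*\<^sub>C\<close> 75)
    and V :: "int \<Rightarrow> 'v set"
    and d :: "'v \<Rightarrow> 'v" +
  fixes Y :: "'v \<Rightarrow> int \<Rightarrow> 'v \<Rightarrow> 'v"
    and vac :: 'v
  assumes Y_linear_left: "Vector_Spaces.linear scale scale (\<lambda>u. Y u n v)"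
    and Y_linear_right: "Vector_Spaces.linear scale scale (Y u n)"
    and Y_deg: "\<lbrakk>u \<in> V p; v \<in> V q\<rbrakk> \<Longrightarrow> Y u n v \<in> V (q + (p - 2 * n - 2))"
    and Y_d: "u \<in> V p \<Longrightarrow> Y (d u) n v = d (Y u n v) - ((-1) powi p) *\<^sub>C Y u n (d v)"
    and vac_deg: "vac \<in> V 0"
    and d_vac: "d vac = 0"
    and truncation: "\<exists>N. \<forall>n\<ge>N. Y u n v = 0"
    and Y_vac: "Y vac n v = (if n = -1 then v else 0)"
    and creation: "n \<ge> 0 \<Longrightarrow> Y v n vac = 0" "Y v (-1) vac = v"
    and jacobi: "\<lbrakk>u \<in> V p; v \<in> V q\<rbrakk> \<Longrightarrow>
      Sum_any (\<lambda>i::nat. ((-1) ^ i * (of_int l gchoose i)) *\<^sub>C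
        (Y u (m + l - int i) (Y v (n + int i) x)
          - ((-1) powi l * (-1) powi (p * q)) *\<^sub>C Y v (n + l - int i) (Y u (m + int i) x)))
      = Sum_any (\<lambda>i::nat. (of_int m gchoose i) *\<^sub>C Y (Y u (l + int i) v) (m + n - int i) x)"
begin

definition virasoro :: "'v \<Rightarrow> int \<Rightarrow> 'v \<Rightarrow> 'v"
  where "virasoro \<omega> n = Y \<omega> (n + 1)"

definition weight_space :: "'v \<Rightarrow> real \<Rightarrow> 'v set"
  where "weight_space \<omega> n = {v. virasoro \<omega> 0 v = of_real n *\<^sub>C v}"

end

locale dg_vertex_operator_algebra = dg_vertex_algebra scale V d Y vac
  for scale :: "complex \<Rightarrow> 'v::ab_group_add \<Rightarrow> 'v"  (infixr \<open>*\<^sub>C\<close> 75)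
    and V :: "int \<Rightarrow> 'v set"
    and d :: "'v \<Rightarrow> 'v"
    and Y :: "'v \<Rightarrow> int \<Rightarrow> 'v \<Rightarrow> 'v"
    and vac :: 'v +
  fixes \<omega> :: 'v
  assumes omega_deg: "\<omega> \<in> V 4"
    and d_omega: "d \<omega> = 0"
    and virasoro_relations: "\<exists>c. \<forall>m n v.
      virasoro \<omega> m (virasoro \<omega> n v) - virasoro \<omega> n (virasoro \<omega> m v)
      = of_int (m - n) *\<^sub>C virasoro \<omega> (m + n) v
        + (if m + n = 0 then (of_int (m ^ 3 - m) / 12 * c) *\<^sub>C v else 0)"
    and weight_direct_sum: "direct_sum half_ints (weight_space \<omega>)"
    and omega_weight: "\<omega> \<in> weight_space \<omega> 2"
    and weight_finite_dim: "n \<in> half_ints \<Longrightarrow> \<exists>B. finite B \<and> weight_space \<omega> n \<subseteq> span B"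
    and weight_bounded_below: "\<exists>N. \<forall>n\<in>half_ints. n < N \<longrightarrow> weight_space \<omega> n = {0}"
    and virasoro_translation: "virasoro \<omega> (-1) v = Y v (-2) vac"
begin

section \<open>The Zhu algebra and its associated bigraded algebra\<close>

text \<open>\<open>zhu_sum j u v\<close> is \<open>\<Sum>\<^sub>k (wt u choose k) u\<^bsub>k - j\<^esub> v\<close>, extended linearly from weight homogeneous
  \<open>u\<close> by splitting \<open>u\<close> into its weight components.\<close>

definition zhu_sum :: "int \<Rightarrow> 'v \<Rightarrow> 'v \<Rightarrow> 'v"
  where "zhu_sum j u v =
    (let u' = (\<lambda>n. homogeneous_part half_ints (weight_space \<omega>) n u)
     in \<Sum>n\<in>{n \<in> half_ints. u' n \<noteq> 0}.
          Sum_any (\<lambda>k::nat. (of_real n gchoose k) *\<^sub>C Y (u' n) (int k - j) v))"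

definition zhu_mult :: "'v \<Rightarrow> 'v \<Rightarrow> 'v"  (infixl \<open>\<star>\<close> 70)
  where "u \<star> v = zhu_sum 1 u v"

definition zhu_circ :: "'v \<Rightarrow> 'v \<Rightarrow> 'v"
  where "zhu_circ u v = zhu_sum 2 u v"

definition zhu_O :: "'v set"
  where "zhu_O = span {zhu_circ u v | u v. True}"

definition bihom :: "int \<times> real \<Rightarrow> 'v set"
  where "bihom = (\<lambda>(p, n). weight_space \<omega> n \<inter> V p)"

text \<open>\<open>lower (p, n)\<close> is \<open>I\<^sub>n\<^bsup>[p]\<^esup>\<close>: the subspace generated by \<open>O(V)\<close> and the bihomogeneous vectors of
  strictly smaller bidegree.\<close>

definition lower :: "int \<times> real \<Rightarrow> 'v set"
  where "lower = (\<lambda>(p, n). span (zhu_O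
    \<union> \<Union> {bihom (q, m) | q m. m \<in> half_ints \<and> q \<le> p \<and> m < n}
    \<union> \<Union> {bihom (q, m) | q m. m \<in> half_ints \<and> q < p \<and> m \<le> n}))"

abbreviation bidegs :: "(int \<times> real) set"
  where "bidegs \<equiv> UNIV \<times> half_ints"

definition gr_component :: "int \<times> real \<Rightarrow> 'v set set"
  where "gr_component i = {u +o lower i | u. u \<in> bihom i}"

text \<open>Operations on classes. No representatives are chosen: the union runs over all bihomogeneous
  representatives of the given classes. It is a single coset exactly when the class of the result
  does not depend on the representatives; otherwise it is not an element of any
  \<open>gr_component\<close>.\<close>

definition class_mult :: "int \<times> real \<Rightarrow> int \<times> real \<Rightarrow> 'v set \<Rightarrow> 'v set \<Rightarrow> 'v set"
  where "class_mult = (\<lambda>(p1, n1) (p2, n2) A B.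
    \<Union>u \<in> A \<inter> bihom (p1, n1). \<Union>v \<in> B \<inter> bihom (p2, n2).
      (u \<star> v) +o lower (p1 + p2, n1 + n2))"

definition class_bracket :: "int \<times> real \<Rightarrow> int \<times> real \<Rightarrow> 'v set \<Rightarrow> 'v set \<Rightarrow> 'v set"
  where "class_bracket = (\<lambda>(p1, n1) (p2, n2) A B.
    \<Union>u \<in> A \<inter> bihom (p1, n1). \<Union>v \<in> B \<inter> bihom (p2, n2).
      (u \<star> v - ((-1) powi (p1 * p2)) *\<^sub>C (v \<star> u)) +o lower (p1 + p2 - 2, n1 + n2 - 1))"

definition class_d :: "int \<times> real \<Rightarrow> 'v set \<Rightarrow> 'v set"
  where "class_d = (\<lambda>(p, n) A. \<Union>u \<in> A \<inter> bihom (p, n). d u +o lower (p + 1, n))"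

text \<open>An element of the direct sum is a family of classes \<open>f\<close> with finite support; the zero of the
  summand of bidegree \<open>i\<close> is the coset \<open>lower i\<close>. Sums of cosets are elementwise, and \<open>lower i\<close> is
  added so that an empty sum, or a multiple by the scalar \<open>0\<close>, is still a coset.\<close>

definition gr_support :: "(int \<times> real \<Rightarrow> 'v set) \<Rightarrow> (int \<times> real) set"
  where "gr_support f = {i \<in> bidegs. f i \<noteq> lower i}"

definition gr_algebra :: "(complex, int \<times> real \<Rightarrow> 'v set) module"
  where "gr_algebra =
    \<lparr>carrier = {f \<in> (\<Pi>\<^sub>E i\<in>bidegs. gr_component i). finite (gr_support f)},
     monoid.mult = (\<lambda>f g. \<lambda>(p, n)\<in>bidegs. lower (p, n) +
       (\<Sum>(p1, n1)\<in>gr_support f.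
          class_mult (p1, n1) (p - p1, n - n1) (f (p1, n1)) (g (p - p1, n - n1)))),
     one = (\<lambda>i\<in>bidegs. if i = (0, 0) then vac +o lower i else lower i),
     ring.zero = (\<lambda>i\<in>bidegs. lower i),
     add = (\<lambda>f g. \<lambda>i\<in>bidegs. f i + g i),
     smult = (\<lambda>z f. \<lambda>i\<in>bidegs. (scale z) ` (f i) + lower i)\<rparr>"

text \<open>The classes of bidegrees \<open>(p1, n1)\<close> and \<open>(p + 2 - p1, n + 1 - n1)\<close> have bracket of bidegree
  \<open>(p, n)\<close>.\<close>

definition gr_bracket ::
    "(int \<times> real \<Rightarrow> 'v set) \<Rightarrow> (int \<times> real \<Rightarrow> 'v set) \<Rightarrow> (int \<times> real \<Rightarrow> 'v set)"
  where "gr_bracket f g = (\<lambda>(p, n)\<in>bidegs. lower (p, n) +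
    (\<Sum>(p1, n1)\<in>gr_support f.
       class_bracket (p1, n1) (p + 2 - p1, n + 1 - n1)
         (f (p1, n1)) (g (p + 2 - p1, n + 1 - n1))))"

definition gr_d :: "(int \<times> real \<Rightarrow> 'v set) \<Rightarrow> (int \<times> real \<Rightarrow> 'v set)"
  where "gr_d f = (\<lambda>(p, n)\<in>bidegs. class_d (p - 1, n) (f (p - 1, n)))"

definition gr_deg :: "int \<Rightarrow> (int \<times> real \<Rightarrow> 'v set) set"
  where "gr_deg p = {f \<in> carrier gr_algebra. \<forall>(q, m)\<in>gr_support f. q = p}"

definition gr_weight :: "real \<Rightarrow> (int \<times> real \<Rightarrow> 'v set) set"
  where "gr_weight n = {f \<in> carrier gr_algebra. \<forall>(q, m)\<in>gr_support f. m = n}"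

end

end

theory Submission
  imports Defs "HOL-Computational_Algebra.Formal_Power_Series"
begin

text \<open>
  The key point is that the operations of the bigraded algebra have simple representatives. Modulo terms of
  lower bidegree, \<open>u \<star> v\<close> is the single mode \<open>u\<^bsub>-1\<^esub> v\<close>, and the commutator
  \<open>u \<star> v - (-1)\<^bsup>|u||v|\<^esup> v \<star> u\<close> is \<open>u\<^sub>0 v\<close>. The bigraded algebra is therefore the quotient of \<open>V\<close> itself
  by the bigraded subspace \<open>gr_kernel\<close> spanned by the intersections \<open>bihom i \<inter> lower i\<close>, with product
  \<open>u\<^bsub>-1\<^esub> v\<close>, bracket \<open>u\<^sub>0 v\<close> and differential \<open>d\<close>; the map \<open>cls\<close> is the projection.

  Several axioms hold in \<open>V\<close> before passing to the quotient. The mode \<open>u\<^sub>0\<close> is a derivation of all modes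
  (\<open>zero_mode_derivation\<close>), which gives the Jacobi identity and the Leibniz rule, and \<open>d\<close> is a derivation of
  all modes. The others hold up to lower bidegree: associativity (\<open>product_associative\<close>) from the Jacobi
  identity of the vertex algebra, graded commutativity and antisymmetry (\<open>product_commutative\<close>,
  \<open>skew_bracket\<close>) from skew symmetry, since \<open>L(-1)\<close> acts modulo \<open>O(V)\<close> as minus the weight.

  The main work is to show that the quotient makes sense, that is, that \<open>O(V)\<close> is compatible with the two
  operations. Zhu's operations are residues of \<open>(1 + x)\<^sup>\<alpha> x\<^bsup>-j\<^esup> Y(u, x) v\<close>, and the commutator of two such
  residues is a sum of residues of the same kind (\<open>res_binomial_commutator\<close>). This shows that \<open>O(V)\<close> is
  stable under \<open>u \<star> _\<close> and under the operator \<open>\<Sum>\<^sub>k (wt u - 1 choose k) u\<^sub>k\<close> with leading term \<open>u\<^sub>0\<close>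
  (\<open>zhu_O_ideal\<close>). The same operations in the other argument are reduced to these by commutativity and
  antisymmetry up to lower bidegree.

  Signs need some care. The subspace \<open>O(V)\<close> is not graded by degree, so a bihomogeneous vector of \<open>lower\<close> is
  a sum of vectors of various degrees, for which the sign in a graded commutator varies. All
  arguments with such decompositions are made with sign-free linear operators; every sign
  that occurs is determined by the degrees of two homogeneous vectors.
\<close>

section \<open>Homogeneous components\<close>

context vector_space
begin

lemma homogeneous_part_decomposes:
  assumes "direct_sum I W"
  shows "i \<in> I \<Longrightarrow> homogeneous_part I W i v \<in> W i"
    and "finite {i \<in> I. homogeneous_part I W i v \<noteq> 0}"
    and "(\<Sum>i\<in>{i \<in> I. homogeneous_part I W i v \<noteq> 0}. homogeneous_part I W i v) = v"
proof -
  have "decomposes I W v (THE f. decomposes I W v f)"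
    using assms unfolding direct_sum_def by (metis theI')
  then show "i \<in> I \<Longrightarrow> homogeneous_part I W i v \<in> W i"
    and "finite {i \<in> I. homogeneous_part I W i v \<noteq> 0}"
    and "(\<Sum>i\<in>{i \<in> I. homogeneous_part I W i v \<noteq> 0}. homogeneous_part I W i v) = v"
    unfolding decomposes_def homogeneous_part_def by auto
qed

text \<open>\<open>decomposes\<close> asks for an extensional family on \<open>I\<close>, so a family given on all indices has to be
  restricted before uniqueness applies. Any finite \<open>S\<close> outside of which \<open>g\<close> vanishes may be used, which
  is what makes linearity easy: two vectors can be decomposed over a common finite index set.\<close>

lemma homogeneous_part_unique:
  assumes "direct_sum I W" and "i \<in> I" and "finite S" and "S \<subseteq> I"
    and "\<And>i. i \<in> I \<Longrightarrow> g i \<in> W i" and "\<And>i. i \<in> I \<Longrightarrow> i \<notin> S \<Longrightarrow> g i = 0"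
    and "v = sum g S"
  shows "homogeneous_part I W i v = g i"
proof -
  have eq: "{i \<in> I. restrict g I i \<noteq> 0} = {i \<in> S. g i \<noteq> 0}"
    using assms(4,6) by auto
  have "sum g S = sum (restrict g I) {i \<in> I. restrict g I i \<noteq> 0}"
    unfolding eq using assms(3,4) by (intro sum.mono_neutral_cong_right) (auto simp: subset_iff)
  then have "v = sum (restrict g I) {i \<in> I. restrict g I i \<noteq> 0}"
    using assms(7) by simp
  moreover have "finite {i \<in> I. restrict g I i \<noteq> 0}"
    unfolding eq using assms(3) by simp
  moreover have "restrict g I \<in> (\<Pi>\<^sub>E i\<in>I. W i)"
    using assms(5) by (simp add: restrict_PiE_iff)
  ultimately have "decomposes I W v (restrict g I)"
    unfolding decomposes_def by blast
  then have "(THE f. decomposes I W v f) = restrict g I"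
    using assms(1) unfolding direct_sum_def by (metis the_equality)
  then show ?thesis
    using assms(2) by (simp add: homogeneous_part_def)
qed

lemma homogeneous_part_sum:
  assumes "direct_sum I W" and "finite S" and "S \<subseteq> I"
    and "\<And>i. i \<in> I \<Longrightarrow> homogeneous_part I W i v \<noteq> 0 \<Longrightarrow> i \<in> S"
  shows "(\<Sum>i\<in>S. homogeneous_part I W i v) = v"
proof -
  have "(\<Sum>i\<in>S. homogeneous_part I W i v)
      = (\<Sum>i\<in>{i \<in> I. homogeneous_part I W i v \<noteq> 0}. homogeneous_part I W i v)"
    using assms by (intro sum.mono_neutral_right) auto
  then show ?thesis
    using homogeneous_part_decomposes(3)[OF assms(1)] by simp
qed

lemma homogeneous_part_homogeneous:
  assumes "direct_sum I W" and "\<And>i. i \<in> I \<Longrightarrow> subspace (W i)"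
    and "i \<in> I" and "j \<in> I" and "v \<in> W j"
  shows "homogeneous_part I W i v = (if i = j then v else 0)"
  using assms by (intro homogeneous_part_unique[where S = "{j}"]) (auto intro: subspace_0)

lemma homogeneous_part_add:
  assumes "direct_sum I W" and "\<And>i. i \<in> I \<Longrightarrow> subspace (W i)" and "i \<in> I"
  shows "homogeneous_part I W i (u + v) = homogeneous_part I W i u + homogeneous_part I W i v"
proof -
  let ?S = "\<lambda>v. {i \<in> I. homogeneous_part I W i v \<noteq> 0}"
  note dec = homogeneous_part_decomposes[OF assms(1)]
  have "(\<Sum>i\<in>?S u \<union> ?S v. homogeneous_part I W i w) = w" if "w = u \<or> w = v" for w
    using dec(2) that by (intro homogeneous_part_sum[OF assms(1)]) auto
  then have "(\<Sum>i\<in>?S u \<union> ?S v. homogeneous_part I W i u + homogeneous_part I W i v) = u + v"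
    by (simp add: sum.distrib)
  then show ?thesis
    using assms dec by (intro homogeneous_part_unique[where S = "?S u \<union> ?S v"])
      (auto intro: subspace_add)
qed

lemma homogeneous_part_scale:
  assumes "direct_sum I W" and "\<And>i. i \<in> I \<Longrightarrow> subspace (W i)" and "i \<in> I"
  shows "homogeneous_part I W i (scale z v) = scale z (homogeneous_part I W i v)"
proof -
  let ?S = "{i \<in> I. homogeneous_part I W i v \<noteq> 0}"
  note dec = homogeneous_part_decomposes[OF assms(1)]
  have "(\<Sum>i\<in>?S. scale z (homogeneous_part I W i v)) = scale z v"
    using dec(3)[of v] by (simp add: scale_sum_right[symmetric])
  then show ?thesis
    using assms dec by (intro homogeneous_part_unique[where S = ?S])
      (auto intro: subspace_scale)
qed

end

lemma half_ints_closed [simp, intro]: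
  "m \<in> half_ints \<Longrightarrow> n \<in> half_ints \<Longrightarrow> m + n \<in> half_ints"
  "m \<in> half_ints \<Longrightarrow> n \<in> half_ints \<Longrightarrow> m - n \<in> half_ints"
  "of_int k \<in> half_ints" "of_nat l \<in> half_ints" "0 \<in> half_ints" "1 \<in> half_ints"
  by (auto simp: half_ints_def distrib_left right_diff_distrib)

section \<open>Binomial series\<close>

lemma neg_power_gchoose_neg_two: "(-1) ^ k * ((-2 :: complex) gchoose k) = of_nat (Suc k)"
proof -
  have "((-2 :: complex) gchoose k) = (-1) ^ k * ((2 + of_nat k - 1) gchoose k)"
    using gbinomial_minus[of "2 :: complex" k] by simp
  moreover have "(2 + of_nat k - 1 :: complex) = of_nat (Suc k)" by simp
  moreover have "(of_nat (Suc k) :: complex) gchoose k = of_nat (Suc k)"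
    by (simp only: binomial_gbinomial[symmetric] binomial_Suc_n)
  ultimately show ?thesis
    by (simp add: mult.assoc[symmetric] power_add[symmetric] flip: mult_2)
qed

text \<open>The left-hand side is, up to a power of \<open>x\<close>, the \<open>i\<close>-th divided derivative of
  \<open>x\<^bsup>-p\<^esup> (1 + x)\<^sup>\<alpha>\<close>, and the right-hand side is its Leibniz rule. On coefficients it is the
  Vandermonde identity for \<open>k + (-p)\<close>.\<close>

lemma gchoose_shift_fps:
  fixes \<alpha> :: complex and p :: int
  shows "Abs_fps (\<lambda>k. (\<alpha> gchoose k) * (of_int (int k - p) gchoose i))
    = (\<Sum>s\<le>i. fps_const ((of_int (- p) gchoose (i - s)) * (\<alpha> gchoose s))
        * (fps_X ^ s * fps_binomial (\<alpha> - of_nat s)))"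
proof (rule fps_ext)
  fix k
  \<comment> \<open>Trinomial revision, extended by zero to \<open>s > k\<close>.\<close>
  have trin: "(\<alpha> gchoose k) * (of_nat k gchoose s)
      = (\<alpha> gchoose s) * (if k < s then 0 else (\<alpha> - of_nat s) gchoose (k - s))" for s
  proof (cases "k < s")
    case True
    then have "(of_nat k :: complex) gchoose s = 0"
      by (simp only: binomial_gbinomial[symmetric]) (simp add: binomial_eq_0)
    with True show ?thesis by simp
  next
    case False
    then show ?thesis
      using gbinomial_trinomial_revision[of s k \<alpha>] by simp
  qed
  have "(of_int (int k - p) :: complex) gchoose i = (of_nat k + of_int (- p)) gchoose i"
    by simp
  also have "\<dots> = (\<Sum>s\<le>i. (of_nat k gchoose s) * (of_int (- p) gchoose (i - s)))"
    by (simp only: gbinomial_Vandermonde[symmetric] atMost_atLeast0)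
  finally have "(\<alpha> gchoose k) * (of_int (int k - p) gchoose i)
      = (\<Sum>s\<le>i. (\<alpha> gchoose k) * (of_nat k gchoose s) * (of_int (- p) gchoose (i - s)))"
    by (simp add: sum_distrib_left mult.assoc)
  then show "fps_nth (Abs_fps (\<lambda>k. (\<alpha> gchoose k) * (of_int (int k - p) gchoose i))) k
    = fps_nth (\<Sum>s\<le>i. fps_const ((of_int (- p) gchoose (i - s)) * (\<alpha> gchoose s))
        * (fps_X ^ s * fps_binomial (\<alpha> - of_nat s))) k"
    unfolding trin
    by (simp add: fps_sum_nth fps_mult_left_const_nth fps_X_power_mult_nth if_distrib[of "(*) _"]
        mult.assoc mult.left_commute mult.commute cong: if_cong)
qed

text \<open>All sums over modes are finite by truncation, but the bound depends on the vectors. Each such sum is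
  therefore written as \<open>\<Sum>k<M\<close> for all large \<open>M\<close>, and identities between several of them are proved for
  one common \<open>M\<close>.\<close>

lemma by_eventually:
  fixes A B :: "nat \<Rightarrow> bool"
  assumes "eventually A sequentially" and "eventually B sequentially"
    and "\<And>M. A M \<Longrightarrow> B M \<Longrightarrow> P"
  shows P
  using eventually_happens[OF eventually_conj[OF assms(1,2)]] assms(3) by auto

lemma by_eventually3:
  fixes A B C :: "nat \<Rightarrow> bool"
  assumes "eventually A sequentially" and "eventually B sequentially" and "eventually C sequentially"
    and "\<And>M. A M \<Longrightarrow> B M \<Longrightarrow> C M \<Longrightarrow> P"
  shows P
  using eventually_happens[OF eventually_conj[OF assms(1) eventually_conj[OF assms(2,3)]]] assms(4)
  by auto

section \<open>Cosets of a subspace\<close>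

context vector_space
begin

lemma coset_eq_iff:
  assumes "subspace L"
  shows "u +o L = v +o L \<longleftrightarrow> u - v \<in> L"
proof
  assume "u +o L = v +o L"
  moreover have "u \<in> u +o L"
    using subspace_0[OF assms] by (force simp: elt_set_plus_def)
  ultimately show "u - v \<in> L"
    by (simp add: set_minus_plus)
next
  assume *: "u - v \<in> L"
  show "u +o L = v +o L"
  proof (rule Set.set_eqI)
    fix x
    have "x - u \<in> L \<longleftrightarrow> x - v \<in> L"
      using subspace_add[OF assms, of "x - u" "u - v"] subspace_diff[OF assms, of "x - v" "u - v"] *
      by auto
    then show "x \<in> u +o L \<longleftrightarrow> x \<in> v +o L"
      by (simp add: set_minus_plus)
  qed
qed

lemma coset_eq_self_iff: "subspace L \<Longrightarrow> u +o L = L \<longleftrightarrow> u \<in> L"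
  using coset_eq_iff[of L u 0] by simp

lemma subspace_plus_self: "subspace L \<Longrightarrow> L + L = L"
  using subspace_add subspace_0 by (force simp: set_plus_def)

lemma coset_add: "subspace L \<Longrightarrow> (u +o L) + (v +o L) = (u + v) +o L"
  by (simp add: set_plus_rearrange subspace_plus_self)

lemma subspace_add_coset: "subspace L \<Longrightarrow> L + (u +o L) = u +o L"
  by (simp add: set_plus_rearrange4 subspace_plus_self)

lemma coset_scale:
  assumes "subspace L"
  shows "scale z ` (u +o L) + L = scale z u +o L"
proof
  show "scale z ` (u +o L) + L \<subseteq> scale z u +o L"
    using subspace_add[OF assms] subspace_scale[OF assms]
    by (force simp: elt_set_plus_def set_plus_def scale_right_distrib add.assoc)
  have "scale z u \<in> scale z ` (u +o L)"
    using subspace_0[OF assms] by (force simp: elt_set_plus_def)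
  then show "scale z u +o L \<subseteq> scale z ` (u +o L) + L"
    by (rule set_plus_mono3)
qed

lemma coset_sum: "finite S \<Longrightarrow> subspace L \<Longrightarrow> L + (\<Sum>i\<in>S. x i +o L) = sum x S +o L"
proof (induction S rule: finite_induct)
  case (insert i S)
  have "L + (\<Sum>i\<in>insert i S. x i +o L) = (x i +o L) + (L + (\<Sum>i\<in>S. x i +o L))"
    using insert.hyps by (simp add: add.left_commute)
  then show ?case
    using insert by (simp add: coset_add)
qed simp

end

lemma complex_field_simps [simp]:
  "carrier complex_field = UNIV" "x \<otimes>\<^bsub>complex_field\<^esub> y = x * y" "\<one>\<^bsub>complex_field\<^esub> = 1"
  "\<zero>\<^bsub>complex_field\<^esub> = 0" "x \<oplus>\<^bsub>complex_field\<^esub> y = x + y"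
  by (simp_all add: complex_field_def)

lemma cring_complex_field: "cring complex_field"
proof (intro cringI abelian_groupI comm_monoidI)
  fix x :: complex
  show "\<exists>y\<in>carrier complex_field. y \<oplus>\<^bsub>complex_field\<^esub> x = \<zero>\<^bsub>complex_field\<^esub>"
    by (intro bexI[of _ "- x"]) auto
qed (auto simp: algebra_simps)

context dg_vertex_operator_algebra
begin

section \<open>Modes, weights and the bigrading\<close>

interpretation Yl: module_hom scale scale "\<lambda>u. Y u n w" for n w
  using Y_linear_left by (simp add: linear_iff_module_hom)
interpretation Yr: module_hom scale scale "Y u n" for u n
  using Y_linear_right by (simp add: linear_iff_module_hom)
interpretation dl: module_hom scale scale d
  using d_linear by (simp add: linear_iff_module_hom)

lemmas Y_simps = Yl.add Yl.scale Yl.neg Yl.diff Yl.zero Yl.sum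
  Yr.add Yr.scale Yr.neg Yr.diff Yr.zero Yr.sum
lemmas d_simps = dl.add dl.scale dl.neg dl.diff dl.zero dl.sum

text \<open>For \<open>l = 0\<close> only the term \<open>i = 0\<close> survives on the left of the Jacobi identity.\<close>

lemma commutator_formula_fin:
  assumes "u \<in> V p" and "v \<in> V q" and "\<And>i. i \<ge> N \<Longrightarrow> Y u (int i) v = 0"
  shows "Y u m (Y v n w) - ((-1) powi (p * q)) *\<^sub>C Y v n (Y u m w)
    = (\<Sum>i<N. (of_int m gchoose i) *\<^sub>C Y (Y u (int i) v) (m + n - int i) w)"
proof -
  let ?f = "\<lambda>i::nat. ((-1) ^ i * (of_int 0 gchoose i)) *\<^sub>C
        (Y u (m + 0 - int i) (Y v (n + int i) w)
          - ((-1) powi 0 * (-1) powi (p * q)) *\<^sub>C Y v (n + 0 - int i) (Y u (m + int i) w))"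
  have "Sum_any ?f = sum ?f {0}"
  proof (rule Sum_any.expand_superset)
    show "{i. ?f i \<noteq> 0} \<subseteq> {0}"
    proof
      fix i assume "i \<in> {i. ?f i \<noteq> 0}"
      then show "i \<in> {0}" by (cases i) auto
    qed
  qed simp
  also have "\<dots> = Y u m (Y v n w) - ((-1) powi (p * q)) *\<^sub>C Y v n (Y u m w)"
    by simp
  finally have "Y u m (Y v n w) - ((-1) powi (p * q)) *\<^sub>C Y v n (Y u m w)
    = Sum_any (\<lambda>i::nat. (of_int m gchoose i) *\<^sub>C Y (Y u (0 + int i) v) (m + n - int i) w)"
    using jacobi[OF assms(1,2), of 0 m n w] by simp
  also have "\<dots> = (\<Sum>i<N. (of_int m gchoose i) *\<^sub>C Y (Y u (int i) v) (m + n - int i) w)"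
    using assms(3) by (subst Sum_any.expand_superset[where A = "{..<N}"])
      (auto simp: Yl.zero not_less intro: ccontr)
  finally show ?thesis .
qed

lemma truncation_nat: "\<exists>N. \<forall>i\<ge>N. Y u (int i - j) v = 0"
proof -
  obtain M where "\<forall>n\<ge>M. Y u n v = 0" using truncation by blast
  then show ?thesis by (intro exI[of _ "nat (M + j)"]) auto
qed

lemma V_induct:
  assumes "\<And>p v. v \<in> V p \<Longrightarrow> P v" and "P 0" and "\<And>u v. P u \<Longrightarrow> P v \<Longrightarrow> P (u + v)"
  shows "P v"
proof -
  let ?h = "\<lambda>p. homogeneous_part UNIV V p v"
  note dec = homogeneous_part_decomposes[OF V_direct_sum]
  have "P (?h p)" for p
    using assms(1) dec(1) by blast
  note Ph = this
  have "P (sum ?h S)" if "finite S" for S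
    using that by (induction S rule: finite_induct) (use assms(2,3) Ph in auto)
  then show ?thesis
    using dec(2,3)[of v] by metis
qed

text \<open>The Jacobi identity with \<open>l = -2\<close>, \<open>m = 0\<close> and the vacuum as second vector. A mode of the vacuum
  vanishes unless its index is \<open>-1\<close>, so that at most one term of the left-hand side survives, its
  position depending on the sign of \<open>n\<close>.\<close>

lemma translation_mode: "Y (Y u (-2) vac) n w = - of_int n *\<^sub>C Y u (n - 1) w"
proof (induction u rule: V_induct)
  case (1 p u)
  let ?f = "\<lambda>i::nat. ((-1) ^ i * (of_int (-2) gchoose i)) *\<^sub>C
        (Y u (0 + -2 - int i) (Y vac (n + int i) w)
          - ((-1) powi (-2) * (-1) powi (p * 0)) *\<^sub>C Y vac (n + -2 - int i) (Y u (0 + int i) w))"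
  let ?g = "\<lambda>i::nat. (of_int 0 gchoose i) *\<^sub>C Y (Y u (-2 + int i) vac) (0 + n - int i) w"
  have f: "?f = (\<lambda>i. of_nat (Suc i) *\<^sub>C
      ((if n + int i = - 1 then Y u (-2 - int i) w else 0)
        - (if n - 1 = int i then Y u (int i) w else 0)))"
    using neg_power_gchoose_neg_two by (auto simp: Y_vac Y_simps fun_eq_iff)
  have "Sum_any ?g = sum ?g {0}"
  proof (rule Sum_any.expand_superset)
    show "{i. ?g i \<noteq> 0} \<subseteq> {0}"
    proof
      fix i assume "i \<in> {i. ?g i \<noteq> 0}"
      then show "i \<in> {0}" by (cases i) auto
    qed
  qed simp
  then have "Y (Y u (-2) vac) n w = Sum_any ?f"
    using jacobi[OF 1 vac_deg, of "-2" 0 n w] by simp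
  also have "Sum_any ?f = sum ?f {nat (- 1 - n), nat (n - 1)}"
    unfolding f by (rule Sum_any.expand_superset) (auto split: if_splits)
  also have "\<dots> = - of_int n *\<^sub>C Y u (n - 1) w"
  proof (cases "n = 0")
    case True then show ?thesis unfolding f by auto
  next
    case False
    consider "n < 0" | "n > 0" using False by linarith
    then show ?thesis
    proof cases
      assume n: "n < 0"
      define k where "k = nat (-1 - n)"
      have k: "n = - 1 - int k" using n by (simp add: k_def)
      have e: "- 1 - int k - 1 = - 2 - int k" "- int k - 2 = - 2 - int k" by auto
      show ?thesis unfolding f unfolding k by (auto simp: Y_simps scale_left_distrib sum.insert_if e)
    next
      assume n: "n > 0"
      define k where "k = nat (n - 1)"
      have k: "n = 1 + int k" using n by (simp add: k_def)
      show ?thesis unfolding f unfolding k by (auto simp: Y_simps algebra_simps sum.insert_if)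
    qed
  qed
  finally show ?case .
qed (simp_all add: Y_simps scale_right_distrib)

lemma weight_space_iff: "v \<in> weight_space \<omega> n \<longleftrightarrow> Y \<omega> 1 v = of_real n *\<^sub>C v"
  by (simp add: weight_space_def virasoro_def)

text \<open>Since \<open>\<omega>\<close> has even degree, its commutator formula carries no sign, so it is linear in \<open>u\<close> and extends
  from homogeneous to arbitrary vectors. It shows that \<open>u\<^sub>n\<close> shifts weights by \<open>wt u - n - 1\<close>.\<close>

lemma virasoro_zero_mode:
  "Y \<omega> 1 (Y u n v) = Y u n (Y \<omega> 1 v) + Y (Y \<omega> 1 u) n v - of_int (n + 1) *\<^sub>C Y u n v"
proof (induction u rule: V_induct)
  case (1 p u)
  obtain M where M: "\<forall>i\<ge>M. Y \<omega> (int i - 0) u = 0" using truncation_nat by blast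
  let ?g = "\<lambda>i::nat. (of_int 1 gchoose i) *\<^sub>C Y (Y \<omega> (int i) u) (1 + n - int i) v"
  have "Y \<omega> 1 (Y u n v) - ((-1) powi (4 * p)) *\<^sub>C Y u n (Y \<omega> 1 v) = sum ?g {..<M + 2}"
    using M by (intro commutator_formula_fin omega_deg 1) auto
  also have "(-1 :: complex) powi (4 * p) = 1" by (simp add: power_int_mult)
  also have "sum ?g {..<M + 2} = sum ?g {0, 1}"
  proof (rule sum.mono_neutral_right)
    show "\<forall>i\<in>{..<M + 2} - {0, 1}. ?g i = 0"
    proof
      fix i assume "i \<in> {..<M + 2} - {0, 1}"
      then have "(1::nat) < i" by auto
      then have "(of_nat 1 :: complex) gchoose i = 0"
        by (simp only: binomial_gbinomial[symmetric]) (simp add: binomial_eq_0)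
      then show "?g i = 0" by simp
    qed
  qed auto
  also have "\<dots> = Y (Y \<omega> 0 u) (n + 1) v + Y (Y \<omega> 1 u) n v"
    by (simp add: add.commute)
  also have "Y \<omega> 0 u = Y u (-2) vac"
    using virasoro_translation by (simp add: virasoro_def)
  finally show ?case
    by (simp add: translation_mode algebra_simps)
next
  case (3 a b)
  have "Y \<omega> 1 (Y (a + b) n v) = Y \<omega> 1 (Y a n v) + Y \<omega> 1 (Y b n v)"
    by (simp add: Y_simps)
  then show ?case
    unfolding 3 by (simp add: Y_simps scale_right_distrib)
qed (simp add: Y_simps)

lemma weight_space_subspace: "subspace (weight_space \<omega> n)"
  by (rule subspaceI) (auto simp: weight_space_iff Y_simps scale_right_distrib mult.commute)

lemma mode_weight:
  assumes "u \<in> weight_space \<omega> m" and "v \<in> weight_space \<omega> n"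
  shows "Y u k v \<in> weight_space \<omega> (m + n - of_int k - 1)"
  using assms by (simp add: weight_space_iff virasoro_zero_mode Y_simps algebra_simps)

lemma vac_weight: "vac \<in> weight_space \<omega> 0"
  by (simp add: weight_space_iff creation)

lemma d_weight: "u \<in> weight_space \<omega> n \<Longrightarrow> d u \<in> weight_space \<omega> n"
  using Y_d[OF omega_deg, of 1 u]
  by (simp add: weight_space_iff d_omega Y_simps d_simps)

lemma bihom_iff: "u \<in> bihom (p, n) \<longleftrightarrow> u \<in> weight_space \<omega> n \<and> u \<in> V p"
  by (auto simp: bihom_def)

lemma bihom_subspace: "subspace (bihom i)"
  by (cases i) (auto simp: bihom_def intro: subspace_inter weight_space_subspace V_subspace)

lemma vac_bihom: "vac \<in> bihom (0, 0)"
  by (simp add: bihom_iff vac_weight vac_deg)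

lemma mode_bihom:
  assumes "u \<in> bihom (p, m)" and "v \<in> bihom (q, n)"
  shows "Y u k v \<in> bihom (p + q - 2 * k - 2, m + n - of_int k - 1)"
proof -
  have "Y u k v \<in> V (q + (p - 2 * k - 2))"
    using assms by (intro Y_deg) (auto simp: bihom_iff)
  moreover have "q + (p - 2 * k - 2) = p + q - 2 * k - 2" by simp
  ultimately show ?thesis
    using assms mode_weight by (auto simp: bihom_iff)
qed

lemma d_bihom: "u \<in> bihom (p, n) \<Longrightarrow> d u \<in> bihom (p + 1, n)"
  by (simp add: bihom_iff d_weight d_deg)

definition comp :: "int \<times> real \<Rightarrow> 'v \<Rightarrow> 'v"
  where "comp = (\<lambda>(p, n) v.
    homogeneous_part UNIV V p (homogeneous_part half_ints (weight_space \<omega>) n v))"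

text \<open>The operator \<open>L(0)\<close> has degree \<open>0\<close>, so it commutes with the projections to the degrees. This makes the
  two gradings compatible: \<open>V\<close> is the direct sum of the spaces \<open>bihom i\<close>.\<close>

lemma V_part_weight:
  assumes "v \<in> weight_space \<omega> n"
  shows "homogeneous_part UNIV V p v \<in> weight_space \<omega> n"
proof -
  let ?h = "\<lambda>v p. homogeneous_part UNIV V p v"
  let ?S = "{p. ?h v p \<noteq> 0}"
  note dec = homogeneous_part_decomposes[OF V_direct_sum]
  have "Y \<omega> 1 v = Y \<omega> 1 (\<Sum>p\<in>?S. ?h v p)"
    using dec(3) by simp
  then have "?h (Y \<omega> 1 v) p = Y \<omega> 1 (?h v p)"
    using dec Y_deg[OF omega_deg, of _ _ 1]
    by (intro homogeneous_part_unique[OF V_direct_sum, where S = ?S]) (auto simp: Y_simps)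
  then show ?thesis
    using assms by (simp add: weight_space_iff homogeneous_part_scale V_direct_sum V_subspace)
qed

lemma comp_bihom: "i \<in> bidegs \<Longrightarrow> comp i v \<in> bihom i"
  using homogeneous_part_decomposes(1)[OF V_direct_sum]
    homogeneous_part_decomposes(1)[OF weight_direct_sum]
  by (auto simp: comp_def bihom_iff V_part_weight)

lemma comp_add: "i \<in> bidegs \<Longrightarrow> comp i (u + v) = comp i u + comp i v"
  and comp_scale: "i \<in> bidegs \<Longrightarrow> comp i (z *\<^sub>C v) = z *\<^sub>C comp i v"
  by (auto simp: comp_def homogeneous_part_add homogeneous_part_scale V_direct_sum V_subspace
      weight_direct_sum weight_space_subspace)

lemma comp_of_bihom:
  assumes "i \<in> bidegs" and "j \<in> bidegs" and "v \<in> bihom j"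
  shows "comp i v = (if i = j then v else 0)"
proof -
  obtain p n q m where ij: "i = (p, n)" "j = (q, m)" by (cases i, cases j) auto
  have "homogeneous_part half_ints (weight_space \<omega>) n v = (if n = m then v else 0)"
    using assms weight_space_subspace weight_direct_sum
    by (intro homogeneous_part_homogeneous) (auto simp: ij bihom_iff)
  moreover have "homogeneous_part UNIV V p v = (if p = q then v else 0)"
    using assms V_subspace V_direct_sum
    by (intro homogeneous_part_homogeneous) (auto simp: ij bihom_iff)
  moreover have "homogeneous_part UNIV V p 0 = (if p = p then 0 else 0)"
    using V_subspace V_direct_sum subspace_0
    by (intro homogeneous_part_homogeneous) auto
  ultimately show ?thesis
    by (auto simp: comp_def ij)
qed

lemma bihom_induct [consumes 0, case_names bihom zero add]:
  assumes "\<And>p n v. n \<in> half_ints \<Longrightarrow> v \<in> bihom (p, n) \<Longrightarrow> P v"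
    and "P 0" and "\<And>u v. P u \<Longrightarrow> P v \<Longrightarrow> P (u + v)"
  shows "P v"
proof -
  let ?h = "\<lambda>n. homogeneous_part half_ints (weight_space \<omega>) n v"
  let ?g = "\<lambda>n p. homogeneous_part UNIV V p (?h n)"
  have sumP: "P (sum f S)" if "finite S" and "\<And>i. i \<in> S \<Longrightarrow> P (f i)" for f :: "'i \<Rightarrow> 'v" and S
    using that by induction (use assms in auto)
  have "P (?h n)" if "n \<in> half_ints" for n
  proof -
    have "P (\<Sum>p\<in>{p \<in> UNIV. ?g n p \<noteq> 0}. ?g n p)"
      using that comp_bihom[of "(_, n)" v] assms(1)
      by (intro sumP homogeneous_part_decomposes(2)[OF V_direct_sum]) (auto simp: comp_def)
    then show ?thesis
      by (simp only: homogeneous_part_decomposes(3)[OF V_direct_sum])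
  qed
  then have "P (\<Sum>n\<in>{n \<in> half_ints. ?h n \<noteq> 0}. ?h n)"
    by (intro sumP homogeneous_part_decomposes(2)[OF weight_direct_sum]) auto
  then show ?thesis
    by (simp only: homogeneous_part_decomposes(3)[OF weight_direct_sum])
qed

lemma comp_support_finite: "finite {i \<in> bidegs. comp i v \<noteq> 0}"
proof (induction v rule: bihom_induct)
  case (bihom p n v)
  then have "{i \<in> bidegs. comp i v \<noteq> 0} \<subseteq> {(p, n)}"
    using comp_of_bihom[of _ "(p, n)" v] by (auto split: if_splits)
  then show ?case by (rule finite_subset) simp
next
  case zero
  have "comp i 0 = 0" if "i \<in> bidegs" for i
    using comp_scale[OF that, of 0 0] by simp
  then have "{i \<in> bidegs. comp i 0 \<noteq> 0} = {}" by blast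
  then show ?case by (simp only: finite.emptyI)
next
  case (add u v)
  have "{i \<in> bidegs. comp i (u + v) \<noteq> 0} \<subseteq> {i \<in> bidegs. comp i u \<noteq> 0} \<union> {i \<in> bidegs. comp i v \<noteq> 0}"
    using comp_add by auto
  then show ?case using add by (meson finite_UnI finite_subset)
qed

section \<open>Residues of vertex operators\<close>

text \<open>This is the residue of \<open>f(x) x\<^bsup>-j\<^esup> Y(a, x) b\<close>. With \<open>f = (1 + x)\<^bsup>wt a\<^esup>\<close> it is \<open>a \<star> b\<close> for \<open>j = 1\<close> and
  \<open>zhu_circ a b\<close> for \<open>j = 2\<close>; using formal series turns identities for the binomial coefficients of Zhu's
  operations into identities between products of series.\<close>

definition res :: "complex fps \<Rightarrow> int \<Rightarrow> 'v \<Rightarrow> 'v \<Rightarrow> 'v"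
  where "res f j a b = Sum_any (\<lambda>k. fps_nth f k *\<^sub>C Y a (int k - j) b)"

lemma res_eventually:
  "\<forall>\<^sub>F M in sequentially. res f j a b = (\<Sum>k<M. fps_nth f k *\<^sub>C Y a (int k - j) b)"
proof -
  obtain N where N: "\<forall>i\<ge>N. Y a (int i - j) b = 0"
    using truncation_nat by blast
  have "res f j a b = (\<Sum>k<M. fps_nth f k *\<^sub>C Y a (int k - j) b)" if "M \<ge> N" for M
    unfolding res_def
  proof (rule Sum_any.expand_superset)
    show "{k. fps_nth f k *\<^sub>C Y a (int k - j) b \<noteq> 0} \<subseteq> {..<M}"
      using N that by (auto simp: not_less[symmetric] intro: ccontr)
  qed simp
  then show ?thesis by (rule eventually_sequentiallyI)
qed

lemma res_mem:
  assumes "subspace S" and "\<And>k. Y a (int k - j) b \<in> S"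
  shows "res f j a b \<in> S"
proof -
  obtain M where "res f j a b = (\<Sum>k<M. fps_nth f k *\<^sub>C Y a (int k - j) b)"
    using eventually_happens[OF res_eventually[of f j a b]] by auto
  then show ?thesis
    using assms by (auto intro: subspace_sum subspace_scale)
qed

lemma res_add_fps: "res (f + g) j a b = res f j a b + res g j a b"
  using res_eventually[of "f + g" j a b] res_eventually[of f j a b] res_eventually[of g j a b]
  by (rule by_eventually3) (simp add: scale_left_distrib sum.distrib)

lemma res_const_fps: "res (fps_const c * f) j a b = c *\<^sub>C res f j a b"
  using res_eventually[of "fps_const c * f" j a b] res_eventually[of f j a b]
  by (rule by_eventually) (simp add: scale_sum_right)

lemma res_sum_fps: "finite S \<Longrightarrow> res (\<Sum>s\<in>S. f s) j a b = (\<Sum>s\<in>S. res (f s) j a b)"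
  by (induction S rule: finite_induct) (simp_all add: res_add_fps, simp add: res_def)

lemma res_linear_left: "module_hom scale scale (\<lambda>a. res f j a b)"
  unfolding linear_iff_module_hom[symmetric] Vector_Spaces.linear_iff
proof (intro conjI allI)
  show "res f j (a + a') b = res f j a b + res f j a' b" for a a'
    using res_eventually[of f j "a + a'" b] res_eventually[of f j a b] res_eventually[of f j a' b]
    by (rule by_eventually3) (simp add: scale_right_distrib sum.distrib Y_simps)
  show "res f j (z *\<^sub>C a) b = z *\<^sub>C res f j a b" for z a
    using res_eventually[of f j "z *\<^sub>C a" b] res_eventually[of f j a b]
    by (rule by_eventually) (simp add: Y_simps scale_sum_right mult.commute)
qed (rule vector_space_axioms)+

lemma res_linear_right: "module_hom scale scale (res f j a)"
  unfolding linear_iff_module_hom[symmetric] Vector_Spaces.linear_iff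
proof (intro conjI allI)
  show "res f j a (b + b') = res f j a b + res f j a b'" for b b'
    using res_eventually[of f j a "b + b'"] res_eventually[of f j a b] res_eventually[of f j a b']
    by (rule by_eventually3) (simp add: scale_right_distrib sum.distrib Y_simps)
  show "res f j a (z *\<^sub>C b) = z *\<^sub>C res f j a b" for z b
    using res_eventually[of f j a "z *\<^sub>C b"] res_eventually[of f j a b]
    by (rule by_eventually) (simp add: Y_simps scale_sum_right mult.commute)
qed (rule vector_space_axioms)+

interpretation rl: module_hom scale scale "\<lambda>a. res f j a b" for f j b
  by (rule res_linear_left)
interpretation rr: module_hom scale scale "res f j a" for f j a
  by (rule res_linear_right)
lemmas res_simps = rl.add rl.scale rl.neg rl.diff rl.zero rl.sum
  rr.add rr.scale rr.neg rr.diff rr.zero rr.sum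

lemma res_X: "res (fps_X * f) j a b = res f (j - 1) a b"
proof -
  have "\<forall>\<^sub>F M in sequentially. res (fps_X * f) j a b
      = (\<Sum>k<Suc M. fps_nth (fps_X * f) k *\<^sub>C Y a (int k - j) b)"
    using res_eventually by (subst eventually_sequentially_Suc)
  then show ?thesis using res_eventually[of f "j - 1" a b]
    by (rule by_eventually)
      (simp add: sum.lessThan_Suc_shift algebra_simps del: sum.lessThan_Suc)
qed

lemma res_X_power: "res (fps_X ^ s * f) j a b = res f (j - int s) a b"
  by (induction s arbitrary: j) (simp_all add: mult.assoc res_X algebra_simps)

text \<open>Here \<open>(1 + x)\<^bsup>h+1\<^esup> = (1 + x)\<^sup>h + x (1 + x)\<^sup>h\<close>.\<close>

lemma res_pascal:
  "res (fps_binomial (h + 1)) j a b = res (fps_binomial h) j a b + res (fps_binomial h) (j - 1) a b"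
  by (simp add: fps_binomial_add_mult fps_binomial_1 distrib_left res_add_fps res_X
      mult.commute[of _ fps_X])

text \<open>Integration by parts: \<open>Y(L(-1)a, x)\<close> is the derivative of \<open>Y(a, x)\<close>, and a residue of a derivative
  vanishes.\<close>

lemma res_translation:
  "res (fps_binomial (h + 1)) j (Y a (-2) vac) b
    = of_int j *\<^sub>C res (fps_binomial (h + 1)) (j + 1) a b - (h + 1) *\<^sub>C res (fps_binomial h) j a b"
proof -
  let ?y = "\<lambda>k. Y a (int k - j - 1) b"
  have eq: "((h + 1) gchoose k) *\<^sub>C Y (Y a (-2) vac) (int k - j) b
      = of_int j *\<^sub>C ((h + 1) gchoose k) *\<^sub>C ?y k - (of_nat k * ((h + 1) gchoose k)) *\<^sub>C ?y k" for k
  proof -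
    have "((h + 1) gchoose k) * - of_int (int k - j)
        = of_int j * ((h + 1) gchoose k) - of_nat k * ((h + 1) gchoose k)"
      by (simp add: algebra_simps)
    then show ?thesis
      by (simp only: translation_mode scale_scale scale_left_diff_distrib[symmetric])
  qed
  have ev: "\<forall>\<^sub>F M in sequentially. res (fps_binomial (h + 1)) i c b
      = (\<Sum>k<Suc M. fps_nth (fps_binomial (h + 1)) k *\<^sub>C Y c (int k - i) b)" for i c
    using res_eventually by (subst eventually_sequentially_Suc)
  have idx: "int (Suc k) - j - 1 = int k - j" for k
    by simp
  have shift: "(\<Sum>k<Suc M. (of_nat k * ((h + 1) gchoose k)) *\<^sub>C ?y k)
      = (h + 1) *\<^sub>C (\<Sum>k<M. (h gchoose k) *\<^sub>C Y a (int k - j) b)" for M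
    using gbinomial_absorption[of _ "h + 1"]
    by (simp add: sum.lessThan_Suc_shift scale_sum_right idx del: sum.lessThan_Suc of_nat_Suc)
  obtain M where elim:
      "res (fps_binomial (h + 1)) j (Y a (-2) vac) b
        = (\<Sum>k<Suc M. fps_nth (fps_binomial (h + 1)) k *\<^sub>C Y (Y a (-2) vac) (int k - j) b)"
      "res (fps_binomial (h + 1)) (j + 1) a b
        = (\<Sum>k<Suc M. fps_nth (fps_binomial (h + 1)) k *\<^sub>C Y a (int k - (j + 1)) b)"
      "res (fps_binomial h) j a b = (\<Sum>k<M. fps_nth (fps_binomial h) k *\<^sub>C Y a (int k - j) b)"
    using ev[of j "Y a (-2) vac"] ev[of "j + 1" a] res_eventually[of "fps_binomial h" j a b]
    by (rule by_eventually3)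
  show ?thesis
  proof -
    have "res (fps_binomial (h + 1)) j (Y a (-2) vac) b
      = (\<Sum>k<Suc M. ((h + 1) gchoose k) *\<^sub>C Y (Y a (-2) vac) (int k - j) b)"
      using elim(1) by simp
    also have "\<dots> = of_int j *\<^sub>C (\<Sum>k<Suc M. ((h + 1) gchoose k) *\<^sub>C ?y k)
      - (\<Sum>k<Suc M. (of_nat k * ((h + 1) gchoose k)) *\<^sub>C ?y k)"
      unfolding eq by (simp add: sum_subtractf scale_sum_right del: sum.lessThan_Suc)
    finally show ?thesis
      unfolding shift using elim(2,3) by (simp add: diff_diff_eq del: sum.lessThan_Suc)
  qed
qed

text \<open>The bound on \<open>k\<close> depends on \<open>l\<close>, but only finitely many \<open>l\<close> contribute, so the maximum of the bounds
  works for all of them.\<close>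

lemma res_res_eventually:
  "\<forall>\<^sub>F M in sequentially. res f p u (res g q v w)
    = (\<Sum>k<M. \<Sum>l<M. (fps_nth f k * fps_nth g l) *\<^sub>C Y u (int k - p) (Y v (int l - q) w))"
proof -
  obtain L where L: "\<forall>i\<ge>L. Y v (int i - q) w = 0"
    using truncation_nat by blast
  have "\<forall>\<^sub>F M in sequentially. \<forall>l\<in>{..<L}. res f p u (Y v (int l - q) w)
      = (\<Sum>k<M. fps_nth f k *\<^sub>C Y u (int k - p) (Y v (int l - q) w))"
    by (intro eventually_ball_finite ballI res_eventually) simp
  then show ?thesis
    using res_eventually[of g q v w] eventually_ge_at_top[of L]
  proof eventually_elim
    case (elim M)
    have "res f p u (Y v (int l - q) w)
      = (\<Sum>k<M. fps_nth f k *\<^sub>C Y u (int k - p) (Y v (int l - q) w))" for l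
      using elim(1) L by (cases "l < L") (auto simp: res_simps Y_simps)
    then have "res f p u (res g q v w)
      = (\<Sum>l<M. fps_nth g l *\<^sub>C (\<Sum>k<M. fps_nth f k *\<^sub>C Y u (int k - p) (Y v (int l - q) w)))"
      unfolding elim(2) by (simp add: res_simps)
    then show ?case
      by (simp add: scale_sum_right mult.commute) (rule sum.swap)
  qed
qed

text \<open>The square and the triangle \<open>k + l < M\<close> differ only by terms with \<open>k + l \<ge> M\<close>, where the mode vanishes.\<close>

lemma res_product_eventually:
  "\<forall>\<^sub>F M in sequentially.
    (\<Sum>k<M. \<Sum>l<M. (fps_nth f k * fps_nth g l) *\<^sub>C Y a (int k + int l - j) w) = res (f * g) j a w"
proof -
  obtain N where N: "\<forall>i\<ge>N. Y a (int i - j) w = 0"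
    using truncation_nat by blast
  show ?thesis
    using res_eventually[of "f * g" j a w] eventually_ge_at_top[of N]
  proof eventually_elim
    case (elim M)
    let ?t = "\<lambda>k l. (fps_nth f k * fps_nth g l) *\<^sub>C Y a (int k + int l - j) w"
    have "(\<Sum>k<M. \<Sum>l<M. ?t k l) = (\<Sum>(k, l)\<in>{..<M} \<times> {..<M}. ?t k l)"
      by (simp add: sum.cartesian_product)
    also have "\<dots> = (\<Sum>(k, l)\<in>{(k, l). k + l < M}. ?t k l)"
    proof (intro sum.mono_neutral_right ballI)
      fix x assume x: "x \<in> {..<M} \<times> {..<M} - {(k, l). k + l < M}"
      obtain k l where [simp]: "x = (k, l)" by (cases x)
      have "Y a (int (k + l) - j) w = 0"
        using x elim(2) by (intro N[rule_format]) auto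
      then show "(case x of (k, l) \<Rightarrow> ?t k l) = 0" by simp
    qed auto
    also have "\<dots> = (\<Sum>n<M. \<Sum>k\<le>n. ?t k (n - k))"
      by (rule sum.triangle_reindex)
    also have "\<dots> = (\<Sum>n<M. fps_nth (f * g) n *\<^sub>C Y a (int n - j) w)"
      by (simp add: fps_mult_nth scale_sum_left atMost_atLeast0 of_nat_diff)
    finally show ?case using elim(1) by simp
  qed
qed

text \<open>The commutator formula with coefficients. The binomial coefficient \<open>(k - p choose i)\<close> depends on the
  first mode only, so it is absorbed into the first series, and the double sum over the modes becomes
  the product of two series.\<close>

lemma res_commutator:
  assumes "u \<in> V p'" and "v \<in> V q'" and "\<And>i. i \<ge> N \<Longrightarrow> Y u (int i) v = 0"
  shows "res f p u (res g q v w) - ((-1) powi (p' * q')) *\<^sub>C res g q v (res f p u w)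
    = (\<Sum>i<N. res (Abs_fps (\<lambda>k. fps_nth f k * (of_int (int k - p) gchoose i)) * g)
        (p + q + int i) (Y u (int i) v) w)"
proof -
  let ?F = "\<lambda>i. Abs_fps (\<lambda>k. fps_nth f k * (of_int (int k - p) gchoose i))"
  have "\<forall>\<^sub>F M in sequentially. \<forall>i\<in>{..<N}. (\<Sum>k<M. \<Sum>l<M. (fps_nth (?F i) k * fps_nth g l) *\<^sub>C
      Y (Y u (int i) v) (int k + int l - (p + q + int i)) w)
      = res (?F i * g) (p + q + int i) (Y u (int i) v) w"
    by (intro eventually_ball_finite ballI res_product_eventually) simp
  then obtain M where elim:
      "\<forall>i\<in>{..<N}. (\<Sum>k<M. \<Sum>l<M. (fps_nth (?F i) k * fps_nth g l) *\<^sub>C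
        Y (Y u (int i) v) (int k + int l - (p + q + int i)) w)
        = res (?F i * g) (p + q + int i) (Y u (int i) v) w"
      "res f p u (res g q v w)
        = (\<Sum>k<M. \<Sum>l<M. (fps_nth f k * fps_nth g l) *\<^sub>C Y u (int k - p) (Y v (int l - q) w))"
      "res g q v (res f p u w)
        = (\<Sum>l<M. \<Sum>k<M. (fps_nth g l * fps_nth f k) *\<^sub>C Y v (int l - q) (Y u (int k - p) w))"
    using res_res_eventually[of f p u g q v w] res_res_eventually[of g q v f p u w]
    by (rule by_eventually3)
  show ?thesis
  proof -
    let ?s = "(-1 :: complex) powi (p' * q')"
    have comm: "Y u (int k - p) (Y v (int l - q) w) - ?s *\<^sub>C Y v (int l - q) (Y u (int k - p) w)
      = (\<Sum>i<N. (of_int (int k - p) gchoose i) *\<^sub>C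
          Y (Y u (int i) v) (int k + int l - (p + q + int i)) w)" for k l
      by (subst commutator_formula_fin[OF assms])
        (auto intro!: sum.cong arg_cong[of _ _ "\<lambda>x. Y _ x w"])
    have "res f p u (res g q v w) - ?s *\<^sub>C res g q v (res f p u w)
      = (\<Sum>k<M. \<Sum>l<M. (fps_nth f k * fps_nth g l) *\<^sub>C
        (Y u (int k - p) (Y v (int l - q) w) - ?s *\<^sub>C Y v (int l - q) (Y u (int k - p) w)))"
      unfolding elim(2,3)
      by (subst (2) sum.swap)
        (simp add: scale_sum_right scale_right_diff_distrib sum_subtractf mult_ac)
    also have "\<dots> = (\<Sum>k<M. \<Sum>l<M. \<Sum>i<N. (fps_nth (?F i) k * fps_nth g l) *\<^sub>C
      Y (Y u (int i) v) (int k + int l - (p + q + int i)) w)"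
      unfolding comm by (simp add: scale_sum_right mult_ac)
    also have "\<dots> = (\<Sum>k<M. \<Sum>i<N. \<Sum>l<M. (fps_nth (?F i) k * fps_nth g l) *\<^sub>C
      Y (Y u (int i) v) (int k + int l - (p + q + int i)) w)"
      by (intro sum.cong refl sum.swap)
    also have "\<dots> = (\<Sum>i<N. \<Sum>k<M. \<Sum>l<M. (fps_nth (?F i) k * fps_nth g l) *\<^sub>C
      Y (Y u (int i) v) (int k + int l - (p + q + int i)) w)"
      by (rule sum.swap)
    finally show ?thesis
      using elim(1) by simp
  qed
qed

text \<open>The shape in which the commutator is used: each summand is again a residue with a power of \<open>1 + x\<close>, so
  that its membership in \<open>O(V)\<close> can be read off from exponent and pole order.\<close>

lemma res_binomial_commutator:
  assumes "u \<in> V p'" and "v \<in> V q'" and "\<And>i. i \<ge> N \<Longrightarrow> Y u (int i) v = 0"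
  shows "res (fps_binomial \<alpha>) p u (res (fps_binomial \<beta>) q v w)
      - ((-1) powi (p' * q')) *\<^sub>C res (fps_binomial \<beta>) q v (res (fps_binomial \<alpha>) p u w)
    = (\<Sum>i<N. \<Sum>s\<le>i. ((of_int (- p) gchoose (i - s)) * (\<alpha> gchoose s)) *\<^sub>C
        res (fps_binomial (\<alpha> + \<beta> - of_nat s)) (p + q + int i - int s) (Y u (int i) v) w)"
proof -
  have "res (Abs_fps (\<lambda>k. fps_nth (fps_binomial \<alpha>) k * (of_int (int k - p) gchoose i))
        * fps_binomial \<beta>) j a w
    = (\<Sum>s\<le>i. ((of_int (- p) gchoose (i - s)) * (\<alpha> gchoose s)) *\<^sub>C
        res (fps_binomial (\<alpha> + \<beta> - of_nat s)) (j - int s) a w)" for i j a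
  proof -
    have b: "fps_binomial (\<alpha> - of_nat s) * fps_binomial \<beta> = fps_binomial (\<alpha> + \<beta> - of_nat s)" for s
      by (simp only: fps_binomial_add_mult[symmetric]) (simp add: algebra_simps)
    show ?thesis
      unfolding fps_binomial_nth gchoose_shift_fps
      by (simp add: sum_distrib_right res_sum_fps mult.assoc b res_const_fps res_X_power)
  qed
  note key = this
  show ?thesis
    by (simp only: res_commutator[OF assms] key)
qed

section \<open>The subspace \<open>O(V)\<close>\<close>

lemma zhu_sum_expand:
  assumes "finite S" and "S \<subseteq> half_ints"
    and "\<And>n. n \<in> half_ints \<Longrightarrow> homogeneous_part half_ints (weight_space \<omega>) n u \<noteq> 0 \<Longrightarrow> n \<in> S"
  shows "zhu_sum j u v
    = (\<Sum>n\<in>S. res (fps_binomial (of_real n)) j (homogeneous_part half_ints (weight_space \<omega>) n u) v)"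
  unfolding zhu_sum_def Let_def res_def[symmetric] fps_binomial_nth[symmetric]
  using assms by (intro sum.mono_neutral_left) (auto simp: rl.zero)

lemma zhu_sum_of_weight:
  assumes "n \<in> half_ints" and "u \<in> weight_space \<omega> n"
  shows "zhu_sum j u v = res (fps_binomial (of_real n)) j u v"
proof -
  have part: "homogeneous_part half_ints (weight_space \<omega>) m u = (if m = n then u else 0)"
    if "m \<in> half_ints" for m
    using that assms weight_direct_sum weight_space_subspace
    by (intro homogeneous_part_homogeneous) auto
  show ?thesis
    using assms(1) part by (subst zhu_sum_expand[where S = "{n}"]) (auto split: if_splits)
qed

lemma zhu_sum_add_left: "zhu_sum j (u + u') v = zhu_sum j u v + zhu_sum j u' v"
proof -
  let ?h = "\<lambda>n u. homogeneous_part half_ints (weight_space \<omega>) n u"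
  let ?S = "{n \<in> half_ints. ?h n u \<noteq> 0} \<union> {n \<in> half_ints. ?h n u' \<noteq> 0}"
  note fin = homogeneous_part_decomposes(2)[OF weight_direct_sum]
  note add = homogeneous_part_add[OF weight_direct_sum weight_space_subspace]
  have "zhu_sum j w v = (\<Sum>n\<in>?S. res (fps_binomial (of_real n)) j (?h n w) v)"
    if "w = u \<or> w = u' \<or> w = u + u'" for w
    using that add[of _ u u'] by (intro zhu_sum_expand) (auto simp: fin)
  note expand = this
  have "(\<Sum>n\<in>?S. res (fps_binomial (of_real n)) j (?h n (u + u')) v)
    = (\<Sum>n\<in>?S. res (fps_binomial (of_real n)) j (?h n u) v
      + res (fps_binomial (of_real n)) j (?h n u') v)"
    using add by (intro sum.cong) (auto simp: rl.add)
  then show ?thesis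
    using expand[of u] expand[of u'] expand[of "u + u'"] by (simp add: sum.distrib)
qed

lemma zhu_O_subspace: "subspace zhu_O"
  by (simp add: zhu_O_def)

lemma res_two_mem_zhu_O:
  "n \<in> half_ints \<Longrightarrow> u \<in> weight_space \<omega> n \<Longrightarrow> res (fps_binomial (of_real n)) 2 u v \<in> zhu_O"
  using zhu_sum_of_weight[of n u 2 v] unfolding zhu_O_def zhu_circ_def
  by (metis (mono_tags, lifting) mem_Collect_eq span_base)

text \<open>By linearity in the first argument, \<open>O(V)\<close> is generated by the products of bihomogeneous first
  arguments.\<close>

lemma zhu_O_minimal:
  assumes "subspace S"
    and "\<And>p n u v. n \<in> half_ints \<Longrightarrow> u \<in> bihom (p, n)
      \<Longrightarrow> res (fps_binomial (of_real n)) 2 u v \<in> S"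
  shows "zhu_O \<subseteq> S"
  unfolding zhu_O_def
proof (rule span_minimal)
  have "zhu_circ u v \<in> S" for u v
  proof (induction u rule: bihom_induct)
    case (bihom p n u)
    then show ?case
      using assms(2) by (auto simp: zhu_circ_def bihom_iff zhu_sum_of_weight)
  next
    case zero
    have "zhu_circ 0 v = res (fps_binomial (of_real 0)) 2 0 v"
      unfolding zhu_circ_def by (rule zhu_sum_of_weight) (auto intro: subspace_0 weight_space_subspace)
    then show ?case
      using subspace_0[OF assms(1)] by (simp add: rl.zero)
  next
    case (add u u')
    then show ?case
      using subspace_add[OF assms(1)] by (simp add: zhu_circ_def zhu_sum_add_left)
  qed
  then show "{zhu_circ u v |u v. True} \<subseteq> S" by auto
qed (rule assms)

lemma translation_weight: "u \<in> weight_space \<omega> n \<Longrightarrow> Y u (-2) vac \<in> weight_space \<omega> (n + 1)"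
  using mode_weight[OF _ vac_weight, of u n "-2"] by (simp add: add.commute)

text \<open>Raising the pole order: \<open>L(-1)u\<close> has weight one more than \<open>u\<close>, and the residue for \<open>L(-1)u\<close> and pole
  order \<open>j\<close> is, by integration by parts, \<open>j\<close> times the one for \<open>u\<close> and order \<open>j + 1\<close>, up to residues for \<open>u\<close>
  and order \<open>j\<close>.\<close>

lemma res_higher_pole_mem_zhu_O:
  assumes "n \<in> half_ints" and "u \<in> weight_space \<omega> n" and "j \<ge> 2"
  shows "res (fps_binomial (of_real n)) j u v \<in> zhu_O"
proof -
  have "res (fps_binomial (of_real n)) (2 + int i) u v \<in> zhu_O" for i
    using assms(1,2)
  proof (induction i arbitrary: u n)
    case 0
    then show ?case by (simp add: res_two_mem_zhu_O)
  next
    case (Suc i)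
    let ?j = "2 + int i" and ?h = "of_real n :: complex"
    let ?r = "res (fps_binomial ?h) ?j u v" and ?r' = "res (fps_binomial ?h) (?j + 1) u v"
    have "res (fps_binomial (of_real (n + 1))) ?j (Y u (-2) vac) v \<in> zhu_O"
      using Suc by (intro Suc.IH translation_weight) auto
    then have "of_int ?j *\<^sub>C (?r' + ?r) - (?h + 1) *\<^sub>C ?r \<in> zhu_O"
      by (simp only: of_real_add of_real_1 res_translation) (simp add: res_pascal)
    moreover have r: "?r \<in> zhu_O"
      using Suc by blast
    ultimately have "(of_int ?j *\<^sub>C (?r' + ?r) - (?h + 1) *\<^sub>C ?r) + ((?h + 1) - of_int ?j) *\<^sub>C ?r
        \<in> zhu_O"
      by (intro subspace_add[OF zhu_O_subspace _ subspace_scale[OF zhu_O_subspace]])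
    moreover have "(of_int ?j *\<^sub>C (?r' + ?r) - (?h + 1) *\<^sub>C ?r) + ((?h + 1) - of_int ?j) *\<^sub>C ?r
        = of_int ?j *\<^sub>C ?r'"
      by (simp only: scale_right_distrib scale_left_diff_distrib) simp
    ultimately have "of_int ?j *\<^sub>C ?r' \<in> zhu_O"
      by simp
    then have "inverse (of_int ?j) *\<^sub>C of_int ?j *\<^sub>C ?r' \<in> zhu_O"
      by (rule subspace_scale[OF zhu_O_subspace])
    moreover have "(of_int ?j :: complex) \<noteq> 0"
      by (simp only: of_int_eq_0_iff)
    ultimately have "?r' \<in> zhu_O" by simp
    then show ?case by (simp add: algebra_simps)
  qed
  from this[of "nat (j - 2)"] show ?thesis
    using assms(3) by simp
qed

text \<open>Raising the exponent by one costs at most one order of the pole, by Pascal's rule.\<close>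

lemma res_mem_zhu_O:
  assumes "n \<in> half_ints" and "u \<in> weight_space \<omega> n" and "j \<ge> 2 + int k"
  shows "res (fps_binomial (of_real n + of_nat k)) j u v \<in> zhu_O"
  using assms(3)
proof (induction k arbitrary: j)
  case 0
  then show ?case using assms by (simp add: res_higher_pole_mem_zhu_O)
next
  case (Suc k)
  have "(of_real n + of_nat (Suc k) :: complex) = (of_real n + of_nat k) + 1"
    by simp
  then show ?case
    using Suc zhu_O_subspace by (simp only: res_pascal) (intro subspace_add Suc.IH; simp)
qed

lemma linear_zhu_O:
  assumes "module_hom scale scale T"
    and "\<And>p n u v. n \<in> half_ints \<Longrightarrow> u \<in> bihom (p, n)
      \<Longrightarrow> T (res (fps_binomial (of_real n)) 2 u v) \<in> zhu_O"
    and "x \<in> zhu_O"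
  shows "T x \<in> zhu_O"
proof -
  have "subspace (T -` zhu_O)"
    using module_hom.subspace_vimage[OF assms(1) zhu_O_subspace] .
  then have "zhu_O \<subseteq> T -` zhu_O"
    using assms(2) by (intro zhu_O_minimal) auto
  then show ?thesis using assms(3) by auto
qed

text \<open>The first claim says that \<open>O(V)\<close> is a left ideal for \<open>\<star>\<close>, the second that it is stable under the operator
  that represents the commutator with \<open>u\<close>. In both cases the operator is moved past \<open>v \<circ> _\<close> with the
  commutator formula. What remains are residues for \<open>u\<^sub>i v\<close>, a vector of weight \<open>n + m - i - 1\<close>. For the
  left ideal the exponent exceeds this weight by \<open>i - s + 1\<close> and the pole has order
  \<open>2 + (i - s + 1)\<close>, which is exactly what \<open>res_mem_zhu_O\<close> allows. For the commutator only \<open>s = i\<close> occurs,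
  where the exponent is the weight and the order is \<open>2\<close>.\<close>

lemma zhu_O_ideal:
  assumes "n \<in> half_ints" and "u \<in> bihom (p, n)" and "x \<in> zhu_O"
  shows zhu_O_left_ideal: "res (fps_binomial (of_real n)) 1 u x \<in> zhu_O"
    and zhu_O_bracket_ideal: "res (fps_binomial (of_real n - 1)) 0 u x \<in> zhu_O"
proof -
  have main: "res (fps_binomial \<alpha>) j u (res (fps_binomial (of_real m)) 2 v w) \<in> zhu_O"
    if m: "m \<in> half_ints" and v: "v \<in> bihom (q, m)"
      and mem: "\<And>i s. s \<le> i \<Longrightarrow> ((of_int (- j) gchoose (i - s)) * (\<alpha> gchoose s)) *\<^sub>C
        res (fps_binomial (\<alpha> + of_real m - of_nat s)) (j + 2 + int i - int s) (Y u (int i) v) w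
        \<in> zhu_O"
    for \<alpha> j m v q w
  proof -
    obtain N where "\<forall>i\<ge>N. Y u (int i - 0) v = 0"
      using truncation_nat by blast
    then have comm: "res (fps_binomial \<alpha>) j u (res (fps_binomial (of_real m)) 2 v w)
        = ((-1) powi (p * q)) *\<^sub>C res (fps_binomial (of_real m)) 2 v (res (fps_binomial \<alpha>) j u w)
          + (\<Sum>i<N. \<Sum>s\<le>i. ((of_int (- j) gchoose (i - s)) * (\<alpha> gchoose s)) *\<^sub>C
            res (fps_binomial (\<alpha> + of_real m - of_nat s)) (j + 2 + int i - int s) (Y u (int i) v) w)"
      using res_binomial_commutator[of u p v q N \<alpha> j "of_real m" 2 w] assms(2) v
      by (auto simp: bihom_iff algebra_simps)
    show ?thesis
      unfolding comm
    proof (rule subspace_add[OF zhu_O_subspace])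
      have "v \<in> weight_space \<omega> m"
        using v by (simp add: bihom_iff)
      then show "((-1) powi (p * q)) *\<^sub>C res (fps_binomial (of_real m)) 2 v
          (res (fps_binomial \<alpha>) j u w) \<in> zhu_O"
        by (intro subspace_scale[OF zhu_O_subspace] res_two_mem_zhu_O m)
    qed (intro subspace_sum[OF zhu_O_subspace] mem, simp)
  qed
  have wt: "Y u (int i) v \<in> weight_space \<omega> (n + m - real i - 1)" if "v \<in> bihom (q, m)" for i v q m
    using mode_weight[of u n v m "int i"] that assms(2) by (simp add: bihom_iff)
  have left: "res (fps_binomial (of_real n)) 1 u (res (fps_binomial (of_real m)) 2 v w) \<in> zhu_O"
    if "m \<in> half_ints" and "v \<in> bihom (q, m)" for m v q w
  proof (rule main[OF that], rule subspace_scale[OF zhu_O_subspace])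
    fix i s :: nat assume "s \<le> i"
    then have e: "of_real n + of_real m - of_nat s
        = (of_real (n + m - real i - 1) + of_nat (i - s + 1) :: complex)"
      by (simp add: of_nat_diff)
    show "res (fps_binomial (of_real n + of_real m - of_nat s)) (1 + 2 + int i - int s)
        (Y u (int i) v) w \<in> zhu_O"
      unfolding e using \<open>s \<le> i\<close> assms that by (intro res_mem_zhu_O wt[OF that(2)]) auto
  qed
  show "res (fps_binomial (of_real n)) 1 u x \<in> zhu_O"
    by (rule linear_zhu_O[OF res_linear_right _ assms(3)]) (rule left)
  have bracket: "res (fps_binomial (of_real n - 1)) 0 u (res (fps_binomial (of_real m)) 2 v w) \<in> zhu_O"
    if "m \<in> half_ints" and "v \<in> bihom (q, m)" for m v q w
  proof (rule main[OF that])
    fix i s :: nat assume "s \<le> i"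
    show "((of_int (- 0) gchoose (i - s)) * ((of_real n - 1) gchoose s)) *\<^sub>C
        res (fps_binomial (of_real n - 1 + of_real m - of_nat s)) (0 + 2 + int i - int s)
          (Y u (int i) v) w \<in> zhu_O"
    proof (cases "s = i")
      case True
      have e: "of_real n - 1 + of_real m - of_nat i = (of_real (n + m - real i - 1) :: complex)"
        by simp
      have "res (fps_binomial (of_real (n + m - real i - 1))) 2 (Y u (int i) v) w \<in> zhu_O"
        using assms that by (intro res_two_mem_zhu_O wt[OF that(2)]) auto
      then show ?thesis
        unfolding True by (simp only: e) (simp add: subspace_scale[OF zhu_O_subspace])
    next
      case False
      then obtain k where "i - s = Suc k"
        using \<open>s \<le> i\<close> by (metis Suc_diff_Suc le_neq_implies_less)
      then show ?thesis
        by (simp add: subspace_0[OF zhu_O_subspace])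
    qed
  qed
  show "res (fps_binomial (of_real n - 1)) 0 u x \<in> zhu_O"
    by (rule linear_zhu_O[OF res_linear_right _ assms(3)]) (rule bracket)
qed

lemma d_res:
  assumes "u \<in> V p"
  shows "d (res f j u v) = res f j (d u) v + ((-1) powi p) *\<^sub>C res f j u (d v)"
proof -
  have d: "d (Y u k v) = Y (d u) k v + ((-1) powi p) *\<^sub>C Y u k (d v)" for k
    using Y_d[OF assms] by simp
  show ?thesis
    using res_eventually[of f j u v] res_eventually[of f j "d u" v] res_eventually[of f j u "d v"]
    by (rule by_eventually3)
      (simp add: d_simps d scale_right_distrib sum.distrib scale_sum_right mult.commute)
qed

lemma d_zhu_O: "x \<in> zhu_O \<Longrightarrow> d x \<in> zhu_O"
proof (rule linear_zhu_O[where T = d])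
  show "module_hom scale scale d" by (rule dl.module_hom_axioms)
  fix p n u v assume n: "n \<in> half_ints" and u: "u \<in> bihom (p, n)"
  have "u \<in> V p" using u by (simp add: bihom_iff)
  then show "d (res (fps_binomial (of_real n)) 2 u v) \<in> zhu_O"
    using n u d_weight[of u n] unfolding d_res[OF \<open>u \<in> V p\<close>]
    by (intro subspace_add[OF zhu_O_subspace] subspace_scale[OF zhu_O_subspace] res_two_mem_zhu_O)
      (simp_all add: bihom_iff)
qed

section \<open>Products modulo lower bidegree\<close>

lemma lower_subspace: "subspace (lower i)"
  by (cases i) (simp add: lower_def)

lemma zhu_O_lower: "zhu_O \<subseteq> lower i"
  by (cases i) (auto simp: lower_def intro: span_base)

lemma bihom_lower:
  assumes "m \<in> half_ints" and "x \<in> bihom (q, m)" and "q \<le> p" and "m \<le> n" and "q < p \<or> m < n"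
  shows "x \<in> lower (p, n)"
  unfolding lower_def prod.case using assms by (intro span_base) blast

lemma lower_minimal:
  assumes "subspace S" and "zhu_O \<subseteq> S"
    and "\<And>q m x. m \<in> half_ints \<Longrightarrow> x \<in> bihom (q, m) \<Longrightarrow> q \<le> p \<Longrightarrow> m \<le> n \<Longrightarrow> q < p \<or> m < n
      \<Longrightarrow> x \<in> S"
  shows "lower (p, n) \<subseteq> S"
  unfolding lower_def prod.case
  by (rule span_minimal) (use assms in \<open>auto simp: less_imp_le\<close>)

lemma lower_mono: "p \<le> p' \<Longrightarrow> n \<le> n' \<Longrightarrow> lower (p, n) \<subseteq> lower (p', n')"
  by (rule lower_minimal[OF lower_subspace zhu_O_lower], erule (1) bihom_lower) auto

text \<open>To see that a linear operator maps one space \<open>lower\<close> into another, it is enough to look at \<open>O(V)\<close> and at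
  bihomogeneous vectors. A vector of \<open>lower\<close> need not have its components there, so this is used for
  operators that do not depend on the degree of their argument, and in particular carry no signs.\<close>

lemma linear_lower:
  assumes "module_hom scale scale T" and "\<And>x. x \<in> zhu_O \<Longrightarrow> T x \<in> lower i"
    and "\<And>q m x. m \<in> half_ints \<Longrightarrow> x \<in> bihom (q, m) \<Longrightarrow> q \<le> p \<Longrightarrow> m \<le> n \<Longrightarrow> q < p \<or> m < n
      \<Longrightarrow> T x \<in> lower i"
    and "x \<in> lower (p, n)"
  shows "T x \<in> lower i"
proof -
  have "lower (p, n) \<subseteq> T -` lower i"
    using assms by (intro lower_minimal module_hom.subspace_vimage[OF assms(1) lower_subspace]) auto
  then show ?thesis using assms(4) by auto
qed

lemma d_lower: "x \<in> lower (p, n) \<Longrightarrow> d x \<in> lower (p + 1, n)"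
proof (rule linear_lower[where p = p and n = n and T = d])
  show "d x \<in> lower (p + 1, n)" if "x \<in> zhu_O" for x
    using d_zhu_O[OF that] zhu_O_lower by blast
  show "d x \<in> lower (p + 1, n)"
    if "m \<in> half_ints" "x \<in> bihom (q, m)" "q \<le> p" "m \<le> n" "q < p \<or> m < n" for q m x
    using that by (intro bihom_lower[OF _ d_bihom]) auto
qed (rule dl.module_hom_axioms)

lemma mode_lower_basic:
  assumes "a \<in> bihom (p, n)" and "x \<in> bihom (q, m)" and "n \<in> half_ints" and "m \<in> half_ints"
    and "p + q - 2 * k - 2 \<le> P" and "n + m - of_int k - 1 \<le> N"
    and "p + q - 2 * k - 2 < P \<or> n + m - of_int k - 1 < N"
  shows "Y a k x \<in> lower (P, N)"
  using assms by (intro bihom_lower[OF _ mode_bihom]) auto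

lemma res_lower:
  assumes "a \<in> bihom (p, n)" and "x \<in> bihom (q, m)" and "n \<in> half_ints" and "m \<in> half_ints"
    and "p + q + 2 * j - 2 \<le> P" and "n + m + of_int j - 1 \<le> N"
    and "p + q + 2 * j - 2 < P \<or> n + m + of_int j - 1 < N"
  shows "res f j a x \<in> lower (P, N)"
  using assms by (intro res_mem[OF lower_subspace] mode_lower_basic[OF assms(1,2)]) auto

text \<open>Splitting off the leading mode; the remaining ones have smaller degree and weight.\<close>

lemma res_head: "res f j a x = fps_nth f 0 *\<^sub>C Y a (- j) x + res (fps_shift 1 f) (j - 1) a x"
proof -
  have "\<forall>\<^sub>F M in sequentially. res f j a x
      = (\<Sum>k<Suc M. fps_nth f k *\<^sub>C Y a (int k - j) x)"
    using res_eventually by (subst eventually_sequentially_Suc)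
  then show ?thesis
    using res_eventually[of "fps_shift 1 f" "j - 1" a x]
    by (rule by_eventually)
      (simp add: sum.lessThan_Suc_shift algebra_simps del: sum.lessThan_Suc)
qed

text \<open>Modes of index at least \<open>-1\<close> do not raise the bidegree beyond the sum of the bidegrees. The other ones do,
  but modulo \<open>O(V)\<close> they can be replaced by modes of larger index, because residues with a pole of order at
  least \<open>2\<close> lie in \<open>O(V)\<close>.\<close>

lemma mode_lower:
  assumes "a \<in> bihom (p, n)" and "x \<in> bihom (q, m)" and "n \<in> half_ints" and "m \<in> half_ints"
    and "p + q \<le> P" and "n + m \<le> N" and "p + q < P \<or> n + m < N"
  shows "Y a k x \<in> lower (P, N)"
proof -
  have nonneg: "Y a k x \<in> lower (P, N)" if "k \<ge> -1" for k
    using assms that by (intro mode_lower_basic[OF assms(1,2)]) auto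
  have neg: "Y a (- int j) x \<in> lower (P, N)" for j
  proof (induction j rule: less_induct)
    case (less j)
    show ?case
    proof (cases "j \<le> 1")
      case True
      then show ?thesis by (intro nonneg) auto
    next
      case False
      let ?B = "fps_binomial (of_real n :: complex)"
      have "res ?B (int j) a x \<in> lower (P, N)"
        using assms False zhu_O_lower by (intro subsetD[OF zhu_O_lower] res_higher_pole_mem_zhu_O)
          (auto simp: bihom_iff)
      moreover have "res (fps_shift 1 ?B) (int j - 1) a x \<in> lower (P, N)"
      proof (rule res_mem[OF lower_subspace])
        fix k
        show "Y a (int k - (int j - 1)) x \<in> lower (P, N)"
        proof (cases "Suc k \<le> j")
          case True
          then have "int k - (int j - 1) = - int (j - Suc k)" by simp
          then show ?thesis using less[of "j - Suc k"] True by (simp add: algebra_simps)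
        qed (auto intro: nonneg)
      qed
      ultimately have "res ?B (int j) a x - res (fps_shift 1 ?B) (int j - 1) a x \<in> lower (P, N)"
        by (rule subspace_diff[OF lower_subspace])
      then show ?thesis
        by (subst (asm) res_head) simp
    qed
  qed
  show ?thesis
    using nonneg[of k] neg[of "nat (- k)"] by (cases "k \<ge> -1") auto
qed

section \<open>Skew symmetry and the leading terms of Zhu's operations\<close>

lemma sign_square [simp]: "((-1 :: complex) powi k) * ((-1) powi k) = 1"
  by (simp add: power_int_add[symmetric] power_int_minus_one_mult_self)

text \<open>The Jacobi identity with \<open>m = -1\<close>, \<open>n = 0\<close>, applied to the vacuum. By the creation property all
  products \<open>u v \<one>\<close> vanish, and of the products \<open>v u \<one>\<close> only the one with \<open>u\<^bsub>-1\<^esub> \<one> = u\<close> is left.\<close>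

lemma skew_symmetry:
  assumes "u \<in> V p" and "v \<in> V q" and "\<And>i. i \<ge> N \<Longrightarrow> Y u (l + int i) v = 0"
  shows "Y v l u = - (((-1) powi l * (-1) powi (p * q)) *\<^sub>C
    (\<Sum>i<N. ((-1) ^ i) *\<^sub>C Y (Y u (l + int i) v) (- 1 - int i) vac))"
proof -
  let ?s = "(-1) powi l * (-1) powi (p * q) :: complex"
  let ?f = "\<lambda>i::nat. ((-1) ^ i * (of_int l gchoose i)) *\<^sub>C
        (Y u (- 1 + l - int i) (Y v (0 + int i) vac)
          - ?s *\<^sub>C Y v (0 + l - int i) (Y u (- 1 + int i) vac))"
  let ?g = "\<lambda>i::nat. (of_int (- 1) gchoose i) *\<^sub>C Y (Y u (l + int i) v) (- 1 + 0 - int i) vac"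
  have "?f i = (if i = 0 then - (?s *\<^sub>C Y v l u) else 0)" for i
    by (cases i) (simp_all add: creation Y_simps)
  then have "Sum_any ?f = - (?s *\<^sub>C Y v l u)"
    by simp
  moreover have "Sum_any ?g = sum ?g {..<N}"
  proof (rule Sum_any.expand_superset)
    show "{i. ?g i \<noteq> 0} \<subseteq> {..<N}"
      using assms(3) by (auto simp: Y_simps not_less[symmetric] intro: ccontr)
  qed simp
  moreover have "?g i = ((-1) ^ i) *\<^sub>C Y (Y u (l + int i) v) (- 1 - int i) vac" for i
    using gbinomial_minus[of "1 :: complex" i] by (simp add: binomial_gbinomial[symmetric])
  ultimately have "- (?s *\<^sub>C Y v l u)
      = (\<Sum>i<N. ((-1) ^ i) *\<^sub>C Y (Y u (l + int i) v) (- 1 - int i) vac)"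
    using jacobi[OF assms(1,2), of l "- 1" 0 vac] by (simp only:)
  then have "?s *\<^sub>C Y v l u
      = - (\<Sum>i<N. ((-1) ^ i) *\<^sub>C Y (Y u (l + int i) v) (- 1 - int i) vac)"
    by (metis minus_minus)
  then have "?s *\<^sub>C ?s *\<^sub>C Y v l u = - (?s *\<^sub>C
      (\<Sum>i<N. ((-1) ^ i) *\<^sub>C Y (Y u (l + int i) v) (- 1 - int i) vac))"
    by simp
  moreover have "?s * ?s = 1"
    using sign_square[of l] sign_square[of "p * q"] by (metis mult.assoc mult.left_commute mult_1_right)
  ultimately show ?thesis by simp
qed

text \<open>The vector \<open>a\<^bsub>-1-i\<^esub> \<one>\<close> is \<open>L(-1)\<^sup>i a / i!\<close>. As \<open>zhu_circ a \<one> = L(-1)a + wt(a) a\<close>, the operator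
  \<open>L(-1)\<close> acts modulo \<open>O(V)\<close> as minus the weight, which grows by one in each step.\<close>

lemma creation_mod_zhu_O:
  assumes "n \<in> half_ints" and "a \<in> weight_space \<omega> n"
  shows "Y a (- 1 - int i) vac - ((- of_real n) gchoose i) *\<^sub>C a \<in> zhu_O"
  using assms
proof (induction i arbitrary: a n)
  case 0
  then show ?case by (simp add: creation subspace_0[OF zhu_O_subspace])
next
  case (Suc i)
  let ?h = "of_real n :: complex" and ?La = "Y a (-2) vac"
  have "res (fps_binomial ?h) 2 a vac \<in> zhu_O"
    using Suc by (intro res_two_mem_zhu_O)
  moreover have "res (fps_binomial ?h) 2 a vac = ?La + ?h *\<^sub>C a"
  proof -
    have "res f 0 a vac = 0" for f
      unfolding res_def by (simp add: creation)
    then show ?thesis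
      by (simp add: res_head[of _ 2] res_head[of _ 1] creation)
  qed
  ultimately have La: "?La + ?h *\<^sub>C a \<in> zhu_O"
    by simp
  \<comment> \<open>The induction hypothesis for \<open>L(-1)a\<close>, whose weight is one more than that of \<open>a\<close>.\<close>
  let ?c = "(- (?h + 1)) gchoose i"
  have "Y ?La (- 1 - int i) vac - ?c *\<^sub>C ?La \<in> zhu_O"
    using Suc.IH[of "n + 1" ?La] Suc.prems translation_weight by simp
  then have "(Y ?La (- 1 - int i) vac - ?c *\<^sub>C ?La) + ?c *\<^sub>C (?La + ?h *\<^sub>C a) \<in> zhu_O"
    by (rule subspace_add[OF zhu_O_subspace _ subspace_scale[OF zhu_O_subspace La]])
  moreover have "Y ?La (- 1 - int i) vac = of_nat (Suc i) *\<^sub>C Y a (- 1 - int (Suc i)) vac"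
    by (simp add: translation_mode algebra_simps)
  moreover have "?c * ?h = - (of_nat (Suc i) * ((- ?h) gchoose Suc i))"
    using gbinomial_absorption[of i "- ?h"]
    by (simp only: minus_add_distrib diff_conv_add_uminus[symmetric]) (simp add: mult.commute)
  ultimately have "of_nat (Suc i) *\<^sub>C (Y a (- 1 - int (Suc i)) vac - ((- ?h) gchoose Suc i) *\<^sub>C a)
      \<in> zhu_O"
    by (simp add: scale_right_distrib scale_right_diff_distrib del: of_nat_Suc)
  then have "inverse (of_nat (Suc i)) *\<^sub>C of_nat (Suc i) *\<^sub>C
      (Y a (- 1 - int (Suc i)) vac - ((- ?h) gchoose Suc i) *\<^sub>C a) \<in> zhu_O"
    by (rule subspace_scale[OF zhu_O_subspace])
  then show ?case
    by (simp del: of_nat_Suc)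
qed

lemma skew_symmetry_mod_zhu_O:
  assumes "u \<in> bihom (p, n)" and "v \<in> bihom (q, m)" and "n \<in> half_ints" and "m \<in> half_ints"
    and "\<And>i. i \<ge> N \<Longrightarrow> Y u (l + int i) v = 0"
  shows "Y v l u + ((-1) powi l * (-1) powi (p * q)) *\<^sub>C
    (\<Sum>i<N. ((-1) ^ i * ((of_int l + of_nat i + 1 - of_real n - of_real m) gchoose i)) *\<^sub>C Y u (l + int i) v)
    \<in> zhu_O"
proof -
  let ?s = "(-1) powi l * (-1) powi (p * q) :: complex"
  have uv: "u \<in> V p" "v \<in> V q"
    using assms by (auto simp: bihom_iff)
  have creation_term: "Y (Y u (l + int i) v) (- 1 - int i) vac
      - ((of_int l + of_nat i + 1 - of_real n - of_real m) gchoose i) *\<^sub>C Y u (l + int i) v \<in> zhu_O" for i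
  proof -
    have e: "- (of_real (n + m - of_int (l + int i) - 1) :: complex)
        = of_int l + of_nat i + 1 - of_real n - of_real m"
      by simp
    have "Y u (l + int i) v \<in> weight_space \<omega> (n + m - of_int (l + int i) - 1)"
      using assms by (intro mode_weight) (auto simp: bihom_iff)
    then show ?thesis
      unfolding e[symmetric] using assms(3,4) by (intro creation_mod_zhu_O half_ints_closed)
  qed
  have "- (?s *\<^sub>C (\<Sum>i<N. ((-1) ^ i) *\<^sub>C (Y (Y u (l + int i) v) (- 1 - int i) vac
      - ((of_int l + of_nat i + 1 - of_real n - of_real m) gchoose i) *\<^sub>C Y u (l + int i) v))) \<in> zhu_O"
    by (intro subspace_neg[OF zhu_O_subspace] subspace_scale[OF zhu_O_subspace]
        subspace_sum[OF zhu_O_subspace] creation_term)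
  then show ?thesis
    using skew_symmetry[OF uv assms(5)]
    by (simp add: scale_right_diff_distrib sum_subtractf)
qed

text \<open>From skew symmetry modulo \<open>O(V)\<close>, where all modes of index at least \<open>1\<close> lie in \<open>lower\<close>. The product has
  to be known up to its second term, since the leading terms cancel in the commutator.\<close>

lemma skew_product_bracket:
  assumes "u \<in> bihom (p, n)" and "v \<in> bihom (q, m)" and "n \<in> half_ints" and "m \<in> half_ints"
  shows skew_product: "Y v (-1) u - ((-1) powi (p * q)) *\<^sub>C
        (Y u (-1) v + (of_real n + of_real m - 1) *\<^sub>C Y u 0 v)
      \<in> lower (p + q - 2, n + m - 1)"
    and skew_bracket: "Y v 0 u + ((-1) powi (p * q)) *\<^sub>C Y u 0 v \<in> lower (p + q - 2, n + m - 1)"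
proof -
  let ?s = "(-1) powi (p * q) :: complex" and ?L = "lower (p + q - 2, n + m - 1)"
  obtain M where M: "\<And>i. i \<ge> M \<Longrightarrow> Y u (int i - 1) v = 0"
    using truncation_nat by blast
  \<comment> \<open>The sums below run two steps, respectively one step, beyond the bound \<open>M\<close>, as their first terms are split off.\<close>
  have M0: "Y u (-1 + int i) v = 0" if "i \<ge> M + 2" for i
    using M[of i] that by (simp add: add.commute)
  have M1: "Y u (0 + int i) v = 0" if "i \<ge> M + 1" for i
    using M[of "Suc i"] that by simp
  have low: "Y u (int i) v \<in> ?L" if "i \<ge> 1" for i
    using assms that by (intro mode_lower_basic[OF assms(1,2)]) auto
  have L: "subspace ?L" by (rule lower_subspace)
  define c where "c i = (-1) ^ i * ((of_int (- 1) + of_nat i + 1 - of_real n - of_real m :: complex) gchoose i)"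
    for i
  define r where "r = (\<Sum>i<M. c (i + 2) *\<^sub>C Y u (int (i + 1)) v)"
  have "(\<Sum>i<M + 2. c i *\<^sub>C Y u (-1 + int i) v)
      = Y u (-1) v + (of_real n + of_real m - 1) *\<^sub>C Y u 0 v + r"
    by (simp add: sum.lessThan_Suc_shift c_def r_def numeral_2_eq_2 algebra_simps del: sum.lessThan_Suc)
  moreover have "Y v (-1) u + ((-1) powi (-1) * ?s) *\<^sub>C (\<Sum>i<M + 2. c i *\<^sub>C Y u (-1 + int i) v) \<in> ?L"
    unfolding c_def
    by (rule subsetD[OF zhu_O_lower skew_symmetry_mod_zhu_O[OF assms M0]])
  moreover have "r \<in> ?L"
    unfolding r_def by (intro subspace_sum[OF L] subspace_scale[OF L] low) simp
  ultimately have "(Y v (-1) u - ?s *\<^sub>C (Y u (-1) v + (of_real n + of_real m - 1) *\<^sub>C Y u 0 v + r))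
      + ?s *\<^sub>C r \<in> ?L"
    by (intro subspace_add[OF L _ subspace_scale[OF L]]) simp_all
  then show "Y v (-1) u - ?s *\<^sub>C (Y u (-1) v + (of_real n + of_real m - 1) *\<^sub>C Y u 0 v) \<in> ?L"
    by (simp add: scale_right_distrib)
  define c' where "c' i = (-1) ^ i * ((of_int 0 + of_nat i + 1 - of_real n - of_real m :: complex) gchoose i)"
    for i
  define r' where "r' = (\<Sum>i<M. c' (i + 1) *\<^sub>C Y u (int (i + 1)) v)"
  have "(\<Sum>i<M + 1. c' i *\<^sub>C Y u (0 + int i) v) = Y u 0 v + r'"
    by (simp add: sum.lessThan_Suc_shift c'_def r'_def del: sum.lessThan_Suc)
  moreover have "Y v 0 u + ((-1) powi 0 * ?s) *\<^sub>C (\<Sum>i<M + 1. c' i *\<^sub>C Y u (0 + int i) v) \<in> ?L"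
    unfolding c'_def
    by (rule subsetD[OF zhu_O_lower skew_symmetry_mod_zhu_O[OF assms M1]])
  moreover have "r' \<in> ?L"
    unfolding r'_def by (intro subspace_sum[OF L] subspace_scale[OF L] low) simp
  ultimately have "(Y v 0 u + ?s *\<^sub>C (Y u 0 v + r')) - ?s *\<^sub>C r' \<in> ?L"
    by (intro subspace_diff[OF L _ subspace_scale[OF L]]) simp_all
  then show "Y v 0 u + ?s *\<^sub>C Y u 0 v \<in> ?L"
    by (simp add: scale_right_distrib)
qed

lemma zhu_mult_bihom:
  "n \<in> half_ints \<Longrightarrow> u \<in> bihom (p, n) \<Longrightarrow> u \<star> v = res (fps_binomial (of_real n)) 1 u v"
  by (simp add: zhu_mult_def zhu_sum_of_weight bihom_iff)

text \<open>The first two terms of the sum that defines \<open>\<star>\<close>.\<close>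

lemma zhu_mult_expand:
  assumes "u \<in> bihom (p, n)" and "v \<in> bihom (q, m)" and "n \<in> half_ints" and "m \<in> half_ints"
  shows "u \<star> v - (Y u (-1) v + of_real n *\<^sub>C Y u 0 v) \<in> lower (p + q - 2, n + m - 1)"
proof -
  let ?B = "fps_binomial (of_real n :: complex)"
  have "u \<star> v = Y u (-1) v + of_real n *\<^sub>C Y u 0 v + res (fps_shift 1 (fps_shift 1 ?B)) (-1) u v"
    using assms by (simp add: zhu_mult_bihom res_head[of _ 1] res_head[of _ 0])
  moreover have "res (fps_shift 1 (fps_shift 1 ?B)) (-1) u v \<in> lower (p + q - 2, n + m - 1)"
    using assms by (intro res_lower[OF assms(1,2)]) auto
  ultimately show ?thesis by simp
qed

lemma lower_zero_mode:
  assumes "u \<in> bihom (p, n)" and "v \<in> bihom (q, m)" and "n \<in> half_ints" and "m \<in> half_ints"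
  shows "Y u 0 v \<in> lower (p + q, n + m)"
  using assms by (intro mode_lower_basic[OF assms(1,2)]) auto

lemma zhu_mult_leading:
  assumes "u \<in> bihom (p, n)" and "v \<in> bihom (q, m)" and "n \<in> half_ints" and "m \<in> half_ints"
  shows "u \<star> v - Y u (-1) v \<in> lower (p + q, n + m)"
proof -
  have "(u \<star> v - (Y u (-1) v + of_real n *\<^sub>C Y u 0 v)) + of_real n *\<^sub>C Y u 0 v \<in> lower (p + q, n + m)"
    using zhu_mult_expand[OF assms] lower_mono[of "p + q - 2" "p + q" "n + m - 1" "n + m"]
    by (intro subspace_add[OF lower_subspace _ subspace_scale[OF lower_subspace]]
        lower_zero_mode[OF assms]) auto
  then show ?thesis by (simp add: algebra_simps)
qed

text \<open>The Zhu commutator is represented by the mode \<open>u\<^sub>0 v\<close>. Expanding both products to second order and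
  exchanging the modes by skew symmetry, the coefficients of \<open>u\<^sub>0 v\<close> add up to
  \<open>n - (n + m - 1) + m = 1\<close>.\<close>

lemma commutator_leading:
  assumes "u \<in> bihom (p, n)" and "v \<in> bihom (q, m)" and "n \<in> half_ints" and "m \<in> half_ints"
  shows "(u \<star> v - ((-1) powi (p * q)) *\<^sub>C (v \<star> u)) - Y u 0 v \<in> lower (p + q - 2, n + m - 1)"
proof -
  let ?s = "(-1) powi (p * q) :: complex" and ?L = "lower (p + q - 2, n + m - 1)"
  have L: "subspace ?L" by (rule lower_subspace)
  \<comment> \<open>The four exact errors: two expansions of Zhu products and two applications of skew symmetry.\<close>
  define A where "A = u \<star> v - (Y u (-1) v + of_real n *\<^sub>C Y u 0 v)"
  define B where "B = v \<star> u - (Y v (-1) u + of_real m *\<^sub>C Y v 0 u)"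
  define C where "C = Y v (-1) u - ?s *\<^sub>C (Y u (-1) v + (of_real n + of_real m - 1) *\<^sub>C Y u 0 v)"
  define D where "D = Y v 0 u + ?s *\<^sub>C Y u 0 v"
  have "A \<in> ?L" unfolding A_def by (rule zhu_mult_expand[OF assms])
  moreover have "B \<in> ?L"
    unfolding B_def using zhu_mult_expand[OF assms(2,1,4,3)] by (simp add: add.commute)
  moreover have "C \<in> ?L" unfolding C_def by (rule skew_product[OF assms])
  moreover have "D \<in> ?L" unfolding D_def by (rule skew_bracket[OF assms])
  ultimately have "A - ?s *\<^sub>C (B + C + of_real m *\<^sub>C D) \<in> ?L"
    by (intro subspace_diff[OF L _ subspace_scale[OF L]] subspace_add[OF L] subspace_scale[OF L])
  also have "A - ?s *\<^sub>C (B + C + of_real m *\<^sub>C D) = (u \<star> v - ?s *\<^sub>C (v \<star> u)) - Y u 0 v"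
  proof -
    have "B + C + of_real m *\<^sub>C D = v \<star> u - ?s *\<^sub>C (Y u (-1) v + (of_real n - 1) *\<^sub>C Y u 0 v)"
      unfolding B_def C_def D_def by (simp add: algebra_simps)
    then show ?thesis
      unfolding A_def by (simp add: scale_right_diff_distrib) (simp add: algebra_simps)
  qed
  finally show ?thesis .
qed

lemma product_commutative:
  assumes "u \<in> bihom (p, n)" and "v \<in> bihom (q, m)" and "n \<in> half_ints" and "m \<in> half_ints"
  shows "Y v (-1) u - ((-1) powi (p * q)) *\<^sub>C Y u (-1) v \<in> lower (p + q, n + m)"
proof -
  let ?s = "(-1) powi (p * q) :: complex" and ?c = "of_real n + of_real m - 1 :: complex"
  have "(Y v (-1) u - ?s *\<^sub>C (Y u (-1) v + ?c *\<^sub>C Y u 0 v)) + (?s * ?c) *\<^sub>C Y u 0 v \<in> lower (p + q, n + m)"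
    using skew_product[OF assms] lower_mono[of "p + q - 2" "p + q" "n + m - 1" "n + m"]
    by (intro subspace_add[OF lower_subspace _ subspace_scale[OF lower_subspace]]
        lower_zero_mode[OF assms]) auto
  then show ?thesis by (simp add: scale_right_distrib)
qed

text \<open>The Jacobi identity with \<open>l = -1\<close>, \<open>m = 0\<close>, \<open>n = -1\<close>. Besides the expected term, all summands apply a
  mode of index at most \<open>-2\<close> to a vector \<open>v\<^sub>i w\<close> or \<open>u\<^sub>i w\<close> with \<open>i \<ge> 0\<close>, which has smaller bidegree, so
  \<open>mode_lower\<close> applies.\<close>

lemma product_associative:
  assumes "u \<in> bihom (p, n)" and "v \<in> bihom (q, m)" and "w \<in> bihom (r, k)"
    and "n \<in> half_ints" and "m \<in> half_ints" and "k \<in> half_ints"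
  shows "Y (Y u (-1) v) (-1) w - Y u (-1) (Y v (-1) w) \<in> lower (p + q + r, n + m + k)"
proof -
  let ?s = "(-1) powi (-1) * (-1) powi (p * q) :: complex" and ?L = "lower (p + q + r, n + m + k)"
  have uv: "u \<in> V p" "v \<in> V q"
    using assms by (auto simp: bihom_iff)
  obtain N1 where N1: "\<And>i. i \<ge> N1 \<Longrightarrow> Y v (int i - 1) w = 0"
    using truncation_nat by blast
  obtain N2 where N2: "\<And>i. i \<ge> N2 \<Longrightarrow> Y u (int i - 0) w = 0"
    using truncation_nat by blast
  define N where "N = N1 + N2"
  let ?f = "\<lambda>i::nat. ((-1) ^ i * (of_int (-1) gchoose i)) *\<^sub>C
        (Y u (0 + -1 - int i) (Y v (- 1 + int i) w)
          - ?s *\<^sub>C Y v (- 1 + -1 - int i) (Y u (0 + int i) w))"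
  let ?g = "\<lambda>i::nat. (of_int 0 gchoose i) *\<^sub>C Y (Y u (- 1 + int i) v) (0 + -1 - int i) w"
  have "?g i = (if i = 0 then Y (Y u (-1) v) (-1) w else 0)" for i
    by (cases i) auto
  then have "Sum_any ?g = Y (Y u (-1) v) (-1) w"
    by simp
  moreover have "Sum_any ?f = sum ?f {..<Suc N}"
  proof (rule Sum_any.expand_superset)
    have "?f i = 0" if "i \<ge> Suc N" for i
      using N1[of i] N2[of i] that by (simp add: N_def Y_simps add.commute)
    then show "{i. ?f i \<noteq> 0} \<subseteq> {..<Suc N}"
      by (auto simp: not_less[symmetric] intro: ccontr)
  qed simp
  moreover have "?f i = Y u (- 1 - int i) (Y v (int i - 1) w) - ?s *\<^sub>C Y v (- 2 - int i) (Y u (int i) w)" for i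
  proof -
    have "(-1) ^ i * ((of_int (-1) :: complex) gchoose i) = 1"
      using gbinomial_minus[of "1 :: complex" i]
      by (simp add: binomial_gbinomial[symmetric] power_add[symmetric] flip: mult_2)
    then show ?thesis by (simp add: add.commute)
  qed
  ultimately have "Y (Y u (-1) v) (-1) w
      = (\<Sum>i<Suc N. Y u (- 1 - int i) (Y v (int i - 1) w) - ?s *\<^sub>C Y v (- 2 - int i) (Y u (int i) w))"
    using jacobi[OF uv, of "-1" 0 "-1" w] by simp
  also have "\<dots> = Y u (-1) (Y v (-1) w) + ((\<Sum>i<N. Y u (- 2 - int i) (Y v (int i) w))
      - ?s *\<^sub>C (\<Sum>i<Suc N. Y v (- 2 - int i) (Y u (int i) w)))"
  proof -
    have "- 1 - int (Suc i) = - 2 - int i" for i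
      by simp
    then have "(\<Sum>i<Suc N. Y u (- 1 - int i) (Y v (int i - 1) w))
        = Y u (-1) (Y v (-1) w) + (\<Sum>i<N. Y u (- 2 - int i) (Y v (int i) w))"
      by (simp add: sum.lessThan_Suc_shift del: sum.lessThan_Suc)
    then show ?thesis
      by (simp only: sum_subtractf scale_sum_right[symmetric] add_diff_eq)
  qed
  finally have eq: "Y (Y u (-1) v) (-1) w - Y u (-1) (Y v (-1) w)
    = (\<Sum>i<N. Y u (- 2 - int i) (Y v (int i) w)) - ?s *\<^sub>C (\<Sum>i<Suc N. Y v (- 2 - int i) (Y u (int i) w))"
    by simp
  have "Y u (- 2 - int i) (Y v (int i) w) \<in> ?L" for i
    using assms by (intro mode_lower[OF assms(1) mode_bihom[OF assms(2,3)]]) auto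
  moreover have "Y v (- 2 - int i) (Y u (int i) w) \<in> ?L" for i
    using assms by (intro mode_lower[OF assms(2) mode_bihom[OF assms(1,3)]]) auto
  ultimately show ?thesis
    unfolding eq by (intro subspace_diff[OF lower_subspace] subspace_scale[OF lower_subspace]
        subspace_sum[OF lower_subspace])
qed

text \<open>Modulo lower terms \<open>u\<^bsub>-1\<^esub> x\<close> is \<open>u \<star> x\<close>, and \<open>x \<mapsto> u \<star> x\<close> preserves \<open>O(V)\<close>.\<close>

lemma product_lower_right:
  assumes "u \<in> bihom (p, n)" and "x \<in> bihom (q, m)" and "x \<in> lower (q, m)"
    and "n \<in> half_ints" and "m \<in> half_ints"
  shows "Y u (-1) x \<in> lower (p + q, n + m)"
proof -
  let ?T = "res (fps_binomial (of_real n)) 1 u"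
  have "?T x \<in> lower (p + q, n + m)"
  proof (rule linear_lower[OF res_linear_right _ _ assms(3)])
    show "?T y \<in> lower (p + q, n + m)" if "y \<in> zhu_O" for y
      using zhu_O_left_ideal[OF assms(4,1) that] zhu_O_lower by blast
    show "?T y \<in> lower (p + q, n + m)"
      if "m' \<in> half_ints" "y \<in> bihom (q', m')" "q' \<le> q" "m' \<le> m" "q' < q \<or> m' < m" for q' m' y
      using that assms by (intro res_lower[OF assms(1) that(2)]) auto
  qed
  moreover have "?T x - Y u (-1) x \<in> lower (p + q, n + m)"
    using zhu_mult_leading[OF assms(1,2,4,5)] assms by (simp add: zhu_mult_bihom)
  ultimately have "?T x - (?T x - Y u (-1) x) \<in> lower (p + q, n + m)"
    by (rule subspace_diff[OF lower_subspace])
  then show ?thesis by simp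
qed

text \<open>Commutativity up to lower terms moves \<open>x\<close> to the right, so it is enough that \<open>O(V)\<close> is a left ideal.\<close>

lemma product_lower_left:
  assumes "u \<in> bihom (p, n)" and "x \<in> bihom (q, m)" and "x \<in> lower (q, m)"
    and "n \<in> half_ints" and "m \<in> half_ints"
  shows "Y x (-1) u \<in> lower (q + p, m + n)"
proof -
  have "(Y x (-1) u - ((-1) powi (p * q)) *\<^sub>C Y u (-1) x) + ((-1) powi (p * q)) *\<^sub>C Y u (-1) x
      \<in> lower (p + q, n + m)"
    using assms by (intro subspace_add[OF lower_subspace _ subspace_scale[OF lower_subspace]]
        product_commutative product_lower_right)
  then show ?thesis by (simp add: add.commute)
qed

text \<open>The commutator \<open>u \<star> x - (-1)\<^bsup>|u||x|\<^esup> x \<star> u\<close> cannot be used directly: the summands of \<open>x\<close> in \<open>O(V)\<close> and in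
  lower bidegree may have degrees of the other parity, and would get the wrong sign. The operator
  \<open>\<Sum>\<^sub>k (n - 1 choose k) u\<^sub>k\<close> has the same leading term \<open>u\<^sub>0\<close>, preserves \<open>O(V)\<close> and involves no sign.\<close>

lemma bracket_lower_right:
  assumes "u \<in> bihom (p, n)" and "x \<in> bihom (q, m)" and "x \<in> lower (q, m)"
    and "n \<in> half_ints" and "m \<in> half_ints"
  shows "Y u 0 x \<in> lower (p + q - 2, n + m - 1)"
proof -
  let ?T = "res (fps_binomial (of_real n - 1)) 0 u"
  have "?T x \<in> lower (p + q - 2, n + m - 1)"
  proof (rule linear_lower[OF res_linear_right _ _ assms(3)])
    show "?T y \<in> lower (p + q - 2, n + m - 1)" if "y \<in> zhu_O" for y
      using zhu_O_bracket_ideal[OF assms(4,1) that] zhu_O_lower by blast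
    show "?T y \<in> lower (p + q - 2, n + m - 1)"
      if "m' \<in> half_ints" "y \<in> bihom (q', m')" "q' \<le> q" "m' \<le> m" "q' < q \<or> m' < m" for q' m' y
      using that assms by (intro res_lower[OF assms(1) that(2)]) auto
  qed
  moreover have "res (fps_shift 1 (fps_binomial (of_real n - 1))) (-1) u x
      \<in> lower (p + q - 2, n + m - 1)"
    using assms by (intro res_lower[OF assms(1,2)]) auto
  ultimately have "?T x - res (fps_shift 1 (fps_binomial (of_real n - 1))) (-1) u x
      \<in> lower (p + q - 2, n + m - 1)"
    by (rule subspace_diff[OF lower_subspace])
  then show ?thesis
    by (subst (asm) res_head) simp
qed

lemma bracket_lower_left:
  assumes "u \<in> bihom (p, n)" and "x \<in> bihom (q, m)" and "x \<in> lower (q, m)"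
    and "n \<in> half_ints" and "m \<in> half_ints"
  shows "Y x 0 u \<in> lower (q + p - 2, m + n - 1)"
proof -
  have "(Y x 0 u + ((-1) powi (p * q)) *\<^sub>C Y u 0 x) - ((-1) powi (p * q)) *\<^sub>C Y u 0 x
      \<in> lower (p + q - 2, n + m - 1)"
    using assms by (intro subspace_diff[OF lower_subspace _ subspace_scale[OF lower_subspace]]
        skew_bracket bracket_lower_right)
  then show ?thesis by (simp add: add.commute)
qed

text \<open>The commutator formula for the mode \<open>u\<^sub>0\<close> has a single term. For \<open>k = 0\<close> and \<open>k = -1\<close> this gives the Jacobi
  identity and the Leibniz rule, without passing to a quotient.\<close>

lemma zero_mode_derivation:
  assumes "u \<in> V p" and "v \<in> V q"
  shows "Y u 0 (Y v k w) = Y (Y u 0 v) k w + ((-1) powi (p * q)) *\<^sub>C Y v k (Y u 0 w)"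
proof -
  obtain N where N: "\<And>i. i \<ge> N \<Longrightarrow> Y u (int i - 0) v = 0"
    using truncation_nat by blast
  have "Y u 0 (Y v k w) - ((-1) powi (p * q)) *\<^sub>C Y v k (Y u 0 w)
    = (\<Sum>i<Suc N. (of_int 0 gchoose i) *\<^sub>C Y (Y u (int i) v) (0 + k - int i) w)"
    by (rule commutator_formula_fin[OF assms]) (use N in auto)
  also have "\<dots> = Y (Y u 0 v) k w"
    by (simp add: sum.lessThan_Suc_shift del: sum.lessThan_Suc)
  finally show ?thesis by (simp add: algebra_simps)
qed

section \<open>The bigraded algebra as a quotient of the vertex algebra\<close>

lemma comp_zero: "i \<in> bidegs \<Longrightarrow> comp i 0 = 0"
  using comp_scale[of i 0 0] by simp

lemma comp_diff: "i \<in> bidegs \<Longrightarrow> comp i (u - v) = comp i u - comp i v"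
  using comp_add[of i "u - v" v] by simp

lemma comp_sum: "finite S \<Longrightarrow> i \<in> bidegs \<Longrightarrow> comp i (\<Sum>j\<in>S. f j) = (\<Sum>j\<in>S. comp i (f j))"
  by (induction S rule: finite_induct) (simp_all add: comp_zero comp_add)

lemma sum_comp:
  assumes "finite S" and "S \<subseteq> bidegs" and "\<And>i. i \<in> bidegs \<Longrightarrow> comp i v \<noteq> 0 \<Longrightarrow> i \<in> S"
  shows "(\<Sum>i\<in>S. comp i v) = v"
proof -
  let ?supp = "\<lambda>v. {i \<in> bidegs. comp i v \<noteq> 0}"
  have extend: "(\<Sum>i\<in>S. comp i v) = (\<Sum>i\<in>?supp v. comp i v)"
    if "finite S" "S \<subseteq> bidegs" "?supp v \<subseteq> S" for S v
    using that by (intro sum.mono_neutral_right) auto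
  have "(\<Sum>i\<in>?supp v. comp i v) = v"
  proof (induction v rule: bihom_induct)
    case (bihom p n v)
    then have "(\<Sum>i\<in>?supp v. comp i v) = (\<Sum>i\<in>{(p, n)}. comp i v)"
      using comp_of_bihom[of _ "(p, n)" v]
      by (intro extend[symmetric]) (auto split: if_splits)
    then show ?case
      using bihom comp_of_bihom[of "(p, n)" "(p, n)" v] by simp
  next
    case zero
    have "?supp 0 = {}"
      using comp_zero by blast
    then show ?case by (simp only: sum.empty)
  next
    case (add u v)
    let ?T = "?supp u \<union> ?supp v"
    have T: "finite ?T" "?T \<subseteq> bidegs"
      using comp_support_finite by auto
    have uv: "?supp (u + v) \<subseteq> ?T"
      using comp_add by auto
    have "(\<Sum>i\<in>?supp (u + v). comp i (u + v)) = (\<Sum>i\<in>?T. comp i (u + v))"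
      using extend[OF T uv] by simp
    also have "\<dots> = (\<Sum>i\<in>?T. comp i u + comp i v)"
      using T by (intro sum.cong refl comp_add) auto
    also have "\<dots> = u + v"
      using extend[OF T, of u] extend[OF T, of v] add by (simp add: sum.distrib)
    finally show ?case .
  qed
  moreover have "?supp v \<subseteq> S"
    using assms(3) by blast
  ultimately show ?thesis
    using extend[OF assms(1,2)] by simp
qed

text \<open>The projection to the degree of \<open>i\<close> does not change the component \<open>i\<close>, and it kills every vector of
  another degree.\<close>

lemma V_iff_comp: "v \<in> V p \<longleftrightarrow> (\<forall>i\<in>bidegs. comp i v \<noteq> 0 \<longrightarrow> fst i = p)"
proof (intro iffI ballI impI)
  fix i assume v: "v \<in> V p" and i: "i \<in> bidegs" and nz: "comp i v \<noteq> 0"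
  have "comp i (homogeneous_part UNIV V (fst i) v) = comp i v" for v
  proof (induction v rule: bihom_induct)
    case (bihom q n v)
    then have "homogeneous_part UNIV V (fst i) v = (if fst i = q then v else 0)"
      using V_direct_sum V_subspace by (intro homogeneous_part_homogeneous) (auto simp: bihom_iff)
    then show ?case
      using bihom i comp_of_bihom[of i "(q, n)" v] by (auto simp: comp_zero)
  next
    case zero
    then show ?case
      using homogeneous_part_homogeneous[OF V_direct_sum V_subspace, of "fst i" "fst i" 0]
      by (simp add: subspace_0[OF V_subspace])
  next
    case (add u v)
    then show ?case
      using i by (simp add: homogeneous_part_add[OF V_direct_sum V_subspace] comp_add)
  qed
  moreover have "homogeneous_part UNIV V (fst i) v = (if fst i = p then v else 0)"
    using V_direct_sum V_subspace v by (intro homogeneous_part_homogeneous) auto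
  ultimately show "fst i = p"
    using nz i by (metis comp_zero)
next
  assume *: "\<forall>i\<in>bidegs. comp i v \<noteq> 0 \<longrightarrow> fst i = p"
  let ?S = "{i \<in> bidegs. comp i v \<noteq> 0}"
  have "(\<Sum>i\<in>?S. comp i v) \<in> V p"
  proof (rule subspace_sum[OF V_subspace])
    fix i assume "i \<in> ?S"
    then show "comp i v \<in> V p"
      using * comp_bihom[of i v] by (cases i) (auto simp: bihom_iff)
  qed
  then show "v \<in> V p"
    using sum_comp[OF comp_support_finite, of v] by auto
qed

lemma weight_space_iff_comp:
  assumes "n \<in> half_ints"
  shows "v \<in> weight_space \<omega> n \<longleftrightarrow> (\<forall>i\<in>bidegs. comp i v \<noteq> 0 \<longrightarrow> snd i = n)"
proof (intro iffI ballI impI)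
  fix i assume v: "v \<in> weight_space \<omega> n" and i: "i \<in> bidegs" and nz: "comp i v \<noteq> 0"
  have "homogeneous_part half_ints (weight_space \<omega>) (snd i) v = (if snd i = n then v else 0)"
    using assms i v weight_direct_sum weight_space_subspace
    by (intro homogeneous_part_homogeneous) auto
  moreover have "homogeneous_part UNIV V (fst i) 0 = (if fst i = fst i then 0 else 0)"
    using V_direct_sum V_subspace subspace_0 by (intro homogeneous_part_homogeneous) auto
  ultimately show "snd i = n"
    using nz by (auto simp: comp_def case_prod_beta split: if_splits)
next
  assume *: "\<forall>i\<in>bidegs. comp i v \<noteq> 0 \<longrightarrow> snd i = n"
  let ?S = "{i \<in> bidegs. comp i v \<noteq> 0}"
  have "(\<Sum>i\<in>?S. comp i v) \<in> weight_space \<omega> n"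
  proof (rule subspace_sum[OF weight_space_subspace])
    fix i assume "i \<in> ?S"
    then show "comp i v \<in> weight_space \<omega> n"
      using * comp_bihom[of i v] by (cases i) (auto simp: bihom_iff)
  qed
  then show "v \<in> weight_space \<omega> n"
    using sum_comp[OF comp_support_finite, of v] by auto
qed

lemma V_bihom_induct [consumes 1, case_names bihom zero add]:
  assumes "v \<in> V p" and "\<And>n v. n \<in> half_ints \<Longrightarrow> v \<in> bihom (p, n) \<Longrightarrow> P v"
    and "P 0" and "\<And>u v. P u \<Longrightarrow> P v \<Longrightarrow> P (u + v)"
  shows "P v"
proof -
  let ?S = "{i \<in> bidegs. comp i v \<noteq> 0}"
  have "P (comp i v)" if "i \<in> ?S" for i
  proof -
    have "fst i = p"
      using assms(1) that V_iff_comp by blast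
    then show ?thesis
      using assms(2)[of "snd i" "comp i v"] comp_bihom[of i v] that by (cases i) auto
  qed
  note Pcomp = this
  have "P (\<Sum>i\<in>T. comp i v)" if "finite T" "T \<subseteq> ?S" for T
    using that by (induction T rule: finite_induct) (use assms(3,4) Pcomp in auto)
  then have "P (\<Sum>i\<in>?S. comp i v)"
    using comp_support_finite by blast
  moreover have "(\<Sum>i\<in>?S. comp i v) = v"
    using comp_support_finite by (intro sum_comp) auto
  ultimately show ?thesis by simp
qed

lemma comp_mode:
  assumes "u \<in> bihom (p1, n1)" and "n1 \<in> half_ints" and "n \<in> half_ints"
  shows "comp (p, n) (Y u k v) = Y u k (comp (p - p1 + 2 * k + 2, n - n1 + of_int k + 1) v)"
proof (induction v rule: bihom_induct)
  case (bihom q m v)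
  have "comp (p, n) (Y u k v) = (if (p, n) = (p1 + q - 2 * k - 2, n1 + m - of_int k - 1) then Y u k v else 0)"
    using assms bihom by (intro comp_of_bihom mode_bihom) auto
  moreover have "comp (p - p1 + 2 * k + 2, n - n1 + of_int k + 1) v
      = (if (p - p1 + 2 * k + 2, n - n1 + of_int k + 1) = (q, m) then v else 0)"
    using assms bihom by (intro comp_of_bihom) auto
  ultimately show ?case
    by (auto simp: Y_simps)
qed (use assms in \<open>simp_all add: Y_simps comp_zero comp_add\<close>)

lemma comp_d: "n \<in> half_ints \<Longrightarrow> comp (p, n) (d v) = d (comp (p - 1, n) v)"
proof (induction v rule: bihom_induct)
  case (bihom q m v)
  then have "comp (p, n) (d v) = (if (p, n) = (q + 1, m) then d v else 0)"
    by (intro comp_of_bihom d_bihom) auto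
  moreover have "comp (p - 1, n) v = (if (p - 1, n) = (q, m) then v else 0)"
    using bihom by (intro comp_of_bihom) auto
  ultimately show ?case
    by (auto simp: d_simps)
qed (simp_all add: d_simps comp_zero comp_add)

text \<open>As \<open>V\<close> is the direct sum of its bihomogeneous parts, a finitely supported family of representatives is the
  same as a vector. This map sends a vector to the family of the classes of its components. It is onto, and
  turns every operation of the bigraded algebra into an operation on \<open>V\<close>.\<close>

definition cls :: "'v \<Rightarrow> int \<times> real \<Rightarrow> 'v set"
  where "cls v = (\<lambda>i\<in>bidegs. comp i v +o lower i)"

definition gr_kernel :: "'v set"
  where "gr_kernel = {v. \<forall>i\<in>bidegs. comp i v \<in> lower i}"

lemma gr_kernel_subspace: "subspace gr_kernel"
  by (rule subspaceI)
    (auto simp: gr_kernel_def comp_zero comp_add comp_scale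
      intro: subspace_0 subspace_add subspace_scale lower_subspace)

text \<open>Identities in the bigraded algebra are checked on bihomogeneous vectors, where the kernel condition is
  just membership in \<open>lower\<close>.\<close>

lemma bihom_gr_kernel:
  assumes "x \<in> bihom (p, n)" and "x \<in> lower (p, n)" and "n \<in> half_ints"
  shows "x \<in> gr_kernel"
  using assms comp_of_bihom[of _ "(p, n)" x] by (auto simp: gr_kernel_def subspace_0 lower_subspace)

lemma cls_eq_iff: "cls u = cls v \<longleftrightarrow> u - v \<in> gr_kernel"
proof -
  have "cls u = cls v \<longleftrightarrow> (\<forall>i\<in>bidegs. comp i u +o lower i = comp i v +o lower i)"
    unfolding cls_def by (metis (no_types, lifting) restrict_apply' restrict_ext)
  then show ?thesis
    by (simp add: gr_kernel_def coset_eq_iff lower_subspace comp_diff)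
qed

lemma gr_support_cls: "gr_support (cls v) = {i \<in> bidegs. comp i v \<notin> lower i}"
  by (auto simp: gr_support_def cls_def coset_eq_self_iff lower_subspace)

lemma gr_support_cls_subset: "gr_support (cls v) \<subseteq> {i \<in> bidegs. comp i v \<noteq> 0}"
  using subspace_0[OF lower_subspace] by (auto simp: gr_support_cls)

lemma finite_gr_support_cls: "finite (gr_support (cls v))"
  using comp_support_finite gr_support_cls_subset by (rule finite_subset[rotated])

lemma cls_carrier: "cls v \<in> carrier gr_algebra"
  using comp_bihom finite_gr_support_cls[of v]
  by (auto simp: gr_algebra_def cls_def gr_component_def)

text \<open>A representative is chosen in each nonzero class only, so that its nonzero components lie over the
  support. This is needed to lift homogeneous families to homogeneous vectors.\<close>

lemma carrier_cls:
  assumes "f \<in> carrier gr_algebra"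
  obtains v where "f = cls v" and "\<And>i. i \<in> bidegs \<Longrightarrow> comp i v \<noteq> 0 \<Longrightarrow> i \<in> gr_support f"
proof -
  let ?S = "gr_support f"
  have f: "f \<in> (\<Pi>\<^sub>E i\<in>bidegs. gr_component i)" and fin: "finite ?S"
    using assms by (auto simp: gr_algebra_def)
  have S: "?S \<subseteq> bidegs"
    by (auto simp: gr_support_def)
  have "\<forall>i\<in>?S. \<exists>x. x \<in> bihom i \<and> f i = x +o lower i"
    using f S by (fastforce simp: gr_component_def PiE_iff)
  then obtain x where x: "\<And>i. i \<in> ?S \<Longrightarrow> x i \<in> bihom i \<and> f i = x i +o lower i"
    by metis
  define v where "v = sum x ?S"
  have comp: "comp i v = (if i \<in> ?S then x i else 0)" if "i \<in> bidegs" for i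
  proof -
    have "comp i v = (\<Sum>j\<in>?S. comp i (x j))"
      unfolding v_def using fin that by (rule comp_sum)
    also have "\<dots> = (\<Sum>j\<in>?S. if i = j then x j else 0)"
      using x S that by (intro sum.cong refl comp_of_bihom) auto
    also have "\<dots> = (if i \<in> ?S then x i else 0)"
      using fin by simp
    finally show ?thesis .
  qed
  have "f = cls v"
  proof (rule PiE_ext[OF f])
    show "cls v \<in> (\<Pi>\<^sub>E i\<in>bidegs. gr_component i)"
      using cls_carrier by (simp add: gr_algebra_def)
    fix i assume i: "i \<in> bidegs"
    show "f i = cls v i"
      using i x[of i] comp[OF i] by (auto simp: cls_def gr_support_def)
  qed
  then show ?thesis
    using comp by (intro that) (auto split: if_splits)
qed

lemma cls_zero: "\<zero>\<^bsub>gr_algebra\<^esub> = cls 0"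
  by (simp add: gr_algebra_def cls_def) (intro restrict_ext, simp add: comp_zero)

lemma cls_one: "\<one>\<^bsub>gr_algebra\<^esub> = cls vac"
proof -
  have "comp i vac = (if i = (0, 0) then vac else 0)" if "i \<in> bidegs" for i
    using that vac_bihom by (intro comp_of_bihom) auto
  then show ?thesis
    by (simp only: gr_algebra_def cls_def module.simps ring.simps monoid.simps)
      (intro restrict_ext, simp)
qed

lemma cls_add: "cls u \<oplus>\<^bsub>gr_algebra\<^esub> cls v = cls (u + v)"
  by (simp add: gr_algebra_def cls_def) (intro restrict_ext, simp add: comp_add coset_add lower_subspace)

lemma cls_smult: "z \<odot>\<^bsub>gr_algebra\<^esub> cls v = cls (z *\<^sub>C v)"
  by (simp add: gr_algebra_def cls_def) (intro restrict_ext, simp add: comp_scale coset_scale lower_subspace)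

lemma UN_const_coset:
  assumes "u \<in> A" and "v \<in> B" and "\<And>u v. u \<in> A \<Longrightarrow> v \<in> B \<Longrightarrow> F u v = C"
  shows "(\<Union>u\<in>A. \<Union>v\<in>B. F u v) = C"
  using assms by auto

lemma mem_coset_self: "u \<in> u +o lower i"
  using set_plus_intro2[OF subspace_0[OF lower_subspace], of u i] by simp

text \<open>The union over all representatives is a single coset: by \<open>zhu_mult_leading\<close> the Zhu product may be replaced
  by \<open>u\<^bsub>-1\<^esub> v\<close>, which is bilinear, and a change of either argument by a bihomogeneous vector of \<open>lower\<close>
  stays in \<open>lower\<close>.\<close>

lemma class_mult_coset:
  assumes "u \<in> bihom (p, n)" and "v \<in> bihom (q, m)" and "n \<in> half_ints" and "m \<in> half_ints"
  shows "class_mult (p, n) (q, m) (u +o lower (p, n)) (v +o lower (q, m))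
    = Y u (-1) v +o lower (p + q, n + m)"
  unfolding class_mult_def prod.case
proof (rule UN_const_coset)
  show "u \<in> (u +o lower (p, n)) \<inter> bihom (p, n)" and "v \<in> (v +o lower (q, m)) \<inter> bihom (q, m)"
    using assms mem_coset_self by auto
  fix u' v' assume u': "u' \<in> (u +o lower (p, n)) \<inter> bihom (p, n)"
    and v': "v' \<in> (v +o lower (q, m)) \<inter> bihom (q, m)"
  have du: "u' - u \<in> lower (p, n)" "u' - u \<in> bihom (p, n)"
    and dv: "v' - v \<in> lower (q, m)" "v' - v \<in> bihom (q, m)"
    using u' v' assms by (auto intro: set_plus_imp_minus subspace_diff[OF bihom_subspace])
  have "(u' \<star> v' - Y u' (-1) v') + (Y (u' - u) (-1) v' + Y u (-1) (v' - v)) \<in> lower (p + q, n + m)"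
    using u' v' zhu_mult_leading[OF _ _ assms(3,4)]
      product_lower_left[OF _ du(2,1) assms(4,3)] product_lower_right[OF assms(1) dv(2,1) assms(3,4)]
    by (intro subspace_add[OF lower_subspace]) blast+
  then show "(u' \<star> v') +o lower (p + q, n + m) = Y u (-1) v +o lower (p + q, n + m)"
    by (simp add: coset_eq_iff lower_subspace Y_simps)
qed

lemma class_bracket_coset:
  assumes "u \<in> bihom (p, n)" and "v \<in> bihom (q, m)" and "n \<in> half_ints" and "m \<in> half_ints"
  shows "class_bracket (p, n) (q, m) (u +o lower (p, n)) (v +o lower (q, m))
    = Y u 0 v +o lower (p + q - 2, n + m - 1)"
  unfolding class_bracket_def prod.case
proof (rule UN_const_coset)
  show "u \<in> (u +o lower (p, n)) \<inter> bihom (p, n)" and "v \<in> (v +o lower (q, m)) \<inter> bihom (q, m)"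
    using assms mem_coset_self by auto
  fix u' v' assume u': "u' \<in> (u +o lower (p, n)) \<inter> bihom (p, n)"
    and v': "v' \<in> (v +o lower (q, m)) \<inter> bihom (q, m)"
  have du: "u' - u \<in> lower (p, n)" "u' - u \<in> bihom (p, n)"
    and dv: "v' - v \<in> lower (q, m)" "v' - v \<in> bihom (q, m)"
    using u' v' assms by (auto intro: set_plus_imp_minus subspace_diff[OF bihom_subspace])
  have "((u' \<star> v' - ((-1) powi (p * q)) *\<^sub>C (v' \<star> u')) - Y u' 0 v')
      + (Y (u' - u) 0 v' + Y u 0 (v' - v)) \<in> lower (p + q - 2, n + m - 1)"
    using u' v' commutator_leading[OF _ _ assms(3,4)]
      bracket_lower_left[OF _ du(2,1) assms(4,3)] bracket_lower_right[OF assms(1) dv(2,1) assms(3,4)]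
    by (intro subspace_add[OF lower_subspace]) blast+
  then show "(u' \<star> v' - ((-1) powi (p * q)) *\<^sub>C (v' \<star> u')) +o lower (p + q - 2, n + m - 1)
      = Y u 0 v +o lower (p + q - 2, n + m - 1)"
    by (simp add: coset_eq_iff lower_subspace Y_simps)
qed

lemma class_d_coset:
  assumes "u \<in> bihom (p, n)"
  shows "class_d (p, n) (u +o lower (p, n)) = d u +o lower (p + 1, n)"
  unfolding class_d_def prod.case
proof (rule SUP_eq_const)
  show "(u +o lower (p, n)) \<inter> bihom (p, n) \<noteq> {}"
    using assms mem_coset_self by blast
  fix u' assume "u' \<in> (u +o lower (p, n)) \<inter> bihom (p, n)"
  then have "d (u' - u) \<in> lower (p + 1, n)"
    by (intro d_lower set_plus_imp_minus) simp
  then show "d u' +o lower (p + 1, n) = d u +o lower (p + 1, n)"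
    by (simp add: coset_eq_iff lower_subspace d_simps)
qed

text \<open>The convolution sum of the classes is the component of \<open>u\<^sub>k v\<close>. The sum over the support of the family
  omits the components of \<open>u\<close> that lie in \<open>lower\<close>; by \<open>low\<close> these do not contribute. It is used for
  \<open>k = -1\<close> (the product) and \<open>k = 0\<close> (the bracket).\<close>

lemma coset_mode_sum:
  assumes "n \<in> half_ints"
    and low: "\<And>p1 n1 p2 n2 x y. n1 \<in> half_ints \<Longrightarrow> n2 \<in> half_ints \<Longrightarrow> x \<in> bihom (p1, n1)
      \<Longrightarrow> x \<in> lower (p1, n1) \<Longrightarrow> y \<in> bihom (p2, n2)
      \<Longrightarrow> Y x k y \<in> lower (p1 + p2 - 2 * k - 2, n1 + n2 - of_int k - 1)"
  shows "lower (p, n) + (\<Sum>(p1, n1)\<in>gr_support (cls u).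
      Y (comp (p1, n1) u) k (comp (p - p1 + 2 * k + 2, n - n1 + of_int k + 1) v) +o lower (p, n))
    = comp (p, n) (Y u k v) +o lower (p, n)"
proof -
  let ?S = "gr_support (cls u)" and ?T = "{i \<in> bidegs. comp i u \<noteq> 0}"
  let ?t = "\<lambda>(p1, n1). Y (comp (p1, n1) u) k (comp (p - p1 + 2 * k + 2, n - n1 + of_int k + 1) v)"
  note sub = gr_support_cls_subset[of u]
  have "comp (p, n) (Y u k v) = comp (p, n) (\<Sum>i\<in>?T. Y (comp i u) k v)"
    using sum_comp[OF comp_support_finite, of u] by (simp flip: Y_simps(6))
  also have "\<dots> = (\<Sum>i\<in>?T. comp (p, n) (Y (comp i u) k v))"
    using assms(1) comp_support_finite by (intro comp_sum) auto
  also have "\<dots> = sum ?t ?T"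
    using assms(1) comp_bihom[of _ u] by (intro sum.cong refl) (auto intro!: comp_mode)
  also have "\<dots> = sum ?t ?S + sum ?t (?T - ?S)"
    using sum.subset_diff[OF sub comp_support_finite, of ?t] by (simp add: add.commute)
  finally have eq: "comp (p, n) (Y u k v) - sum ?t ?S = sum ?t (?T - ?S)"
    by simp
  have "?t i \<in> lower (p, n)" if i: "i \<in> ?T - ?S" for i
  proof -
    obtain p1 n1 where i': "i = (p1, n1)" by (cases i)
    have "Y (comp (p1, n1) u) k (comp (p - p1 + 2 * k + 2, n - n1 + of_int k + 1) v)
      \<in> lower (p1 + (p - p1 + 2 * k + 2) - 2 * k - 2, n1 + (n - n1 + of_int k + 1) - of_int k - 1)"
      using i assms(1) by (intro low comp_bihom) (auto simp: gr_support_cls i')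
    then show ?thesis by (simp add: i')
  qed
  then have "sum ?t (?T - ?S) \<in> lower (p, n)"
    by (rule subspace_sum[OF lower_subspace])
  then have "comp (p, n) (Y u k v) - sum ?t ?S \<in> lower (p, n)"
    by (simp only: eq)
  then have "comp (p, n) (Y u k v) +o lower (p, n) = sum ?t ?S +o lower (p, n)"
    by (rule coset_eq_iff[OF lower_subspace, THEN iffD2])
  also have "\<dots> = lower (p, n) + (\<Sum>i\<in>?S. ?t i +o lower (p, n))"
    by (rule coset_sum[OF finite_gr_support_cls lower_subspace, symmetric])
  finally show ?thesis
    by (simp only: case_prod_beta case_prod_beta')
qed

lemma restrict_bidegs_eqI:
  assumes "\<And>p n. n \<in> half_ints \<Longrightarrow> F (p, n) = G (p, n)"
  shows "restrict F bidegs = restrict G bidegs"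
  using assms by (intro restrict_ext) auto

lemma cls_apply: "n \<in> half_ints \<Longrightarrow> cls v (p, n) = comp (p, n) v +o lower (p, n)"
  by (simp add: cls_def)

lemma cls_mult: "cls u \<otimes>\<^bsub>gr_algebra\<^esub> cls v = cls (Y u (-1) v)"
proof -
  have key: "lower (p, n) + (\<Sum>(p1, n1)\<in>gr_support (cls u).
      class_mult (p1, n1) (p - p1, n - n1) (cls u (p1, n1)) (cls v (p - p1, n - n1)))
    = comp (p, n) (Y u (-1) v) +o lower (p, n)" if n: "n \<in> half_ints" for p n
  proof -
    have "class_mult (p1, n1) (p - p1, n - n1) (cls u (p1, n1)) (cls v (p - p1, n - n1))
      = Y (comp (p1, n1) u) (-1) (comp (p - p1 + 2 * (-1) + 2, n - n1 + of_int (-1) + 1) v) +o lower (p, n)"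
      if "(p1, n1) \<in> gr_support (cls u)" for p1 n1
    proof -
      have n1: "n1 \<in> half_ints"
        using that by (simp add: gr_support_cls)
      have e: "p1 + (p - p1) = p" "n1 + (n - n1) = n"
        "p - p1 + 2 * (-1) + 2 = p - p1" "n - n1 + of_int (-1) + 1 = n - n1"
        by auto
      have i2: "n - n1 \<in> half_ints"
        using n n1 by (intro half_ints_closed)
      have "class_mult (p1, n1) (p - p1, n - n1)
          (comp (p1, n1) u +o lower (p1, n1)) (comp (p - p1, n - n1) v +o lower (p - p1, n - n1))
        = Y (comp (p1, n1) u) (-1) (comp (p - p1, n - n1) v) +o lower (p1 + (p - p1), n1 + (n - n1))"
        by (intro class_mult_coset comp_bihom SigmaI UNIV_I n1 i2)
      then show ?thesis
        by (simp only: cls_apply n1 i2 e)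
    qed
    note summand = this
    have sum_eq: "(\<Sum>(p1, n1)\<in>gr_support (cls u).
        class_mult (p1, n1) (p - p1, n - n1) (cls u (p1, n1)) (cls v (p - p1, n - n1)))
      = (\<Sum>(p1, n1)\<in>gr_support (cls u).
        Y (comp (p1, n1) u) (-1) (comp (p - p1 + 2 * (-1) + 2, n - n1 + of_int (-1) + 1) v) +o lower (p, n))"
    proof (rule sum.cong[OF refl])
      fix i assume "i \<in> gr_support (cls u)"
      then show "(case i of (p1, n1) \<Rightarrow>
          class_mult (p1, n1) (p - p1, n - n1) (cls u (p1, n1)) (cls v (p - p1, n - n1)))
        = (case i of (p1, n1) \<Rightarrow> Y (comp (p1, n1) u) (-1)
            (comp (p - p1 + 2 * (-1) + 2, n - n1 + of_int (-1) + 1) v) +o lower (p, n))"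
        by (cases i) (simp only: prod.case summand)
    qed
    show ?thesis
      unfolding sum_eq
    proof (rule coset_mode_sum[OF n])
      fix p1 n1 p2 n2 x y
      assume "n1 \<in> half_ints" "n2 \<in> half_ints" "x \<in> bihom (p1, n1)" "x \<in> lower (p1, n1)"
        "y \<in> bihom (p2, n2)"
      then have "Y x (-1) y \<in> lower (p1 + p2, n1 + n2)"
        by (intro product_lower_left)
      then show "Y x (-1) y \<in> lower (p1 + p2 - 2 * (-1) - 2, n1 + n2 - of_int (-1) - 1)"
        by simp
    qed
  qed
  have "cls u \<otimes>\<^bsub>gr_algebra\<^esub> cls v = (\<lambda>(p, n)\<in>bidegs. lower (p, n) + (\<Sum>(p1, n1)\<in>gr_support (cls u).
      class_mult (p1, n1) (p - p1, n - n1) (cls u (p1, n1)) (cls v (p - p1, n - n1))))"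
    by (simp add: gr_algebra_def)
  then show ?thesis
    unfolding cls_def[of "Y u (-1) v"] using key by (simp only:) (rule restrict_bidegs_eqI, simp)
qed

lemma cls_bracket: "gr_bracket (cls u) (cls v) = cls (Y u 0 v)"
proof -
  have key: "lower (p, n) + (\<Sum>(p1, n1)\<in>gr_support (cls u).
      class_bracket (p1, n1) (p + 2 - p1, n + 1 - n1) (cls u (p1, n1)) (cls v (p + 2 - p1, n + 1 - n1)))
    = comp (p, n) (Y u 0 v) +o lower (p, n)" if n: "n \<in> half_ints" for p n
  proof -
    have "class_bracket (p1, n1) (p + 2 - p1, n + 1 - n1) (cls u (p1, n1)) (cls v (p + 2 - p1, n + 1 - n1))
      = Y (comp (p1, n1) u) 0 (comp (p - p1 + 2 * 0 + 2, n - n1 + of_int 0 + 1) v) +o lower (p, n)"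
      if "(p1, n1) \<in> gr_support (cls u)" for p1 n1
    proof -
      have n1: "n1 \<in> half_ints"
        using that by (simp add: gr_support_cls)
      have e: "p1 + (p + 2 - p1) - 2 = p" "n1 + (n + 1 - n1) - 1 = n"
        "p - p1 + 2 * 0 + 2 = p + 2 - p1" "n - n1 + of_int 0 + 1 = n + 1 - n1"
        by auto
      have i2: "n + 1 - n1 \<in> half_ints"
        using n n1 by (intro half_ints_closed)
      have "class_bracket (p1, n1) (p + 2 - p1, n + 1 - n1)
          (comp (p1, n1) u +o lower (p1, n1)) (comp (p + 2 - p1, n + 1 - n1) v +o lower (p + 2 - p1, n + 1 - n1))
        = Y (comp (p1, n1) u) 0 (comp (p + 2 - p1, n + 1 - n1) v) +o lower (p1 + (p + 2 - p1) - 2, n1 + (n + 1 - n1) - 1)"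
        by (intro class_bracket_coset comp_bihom SigmaI UNIV_I n1 i2)
      then show ?thesis
        by (simp only: cls_apply n1 i2 e)
    qed
    note summand = this
    have sum_eq: "(\<Sum>(p1, n1)\<in>gr_support (cls u).
        class_bracket (p1, n1) (p + 2 - p1, n + 1 - n1) (cls u (p1, n1)) (cls v (p + 2 - p1, n + 1 - n1)))
      = (\<Sum>(p1, n1)\<in>gr_support (cls u).
        Y (comp (p1, n1) u) 0 (comp (p - p1 + 2 * 0 + 2, n - n1 + of_int 0 + 1) v) +o lower (p, n))"
    proof (rule sum.cong[OF refl])
      fix i assume "i \<in> gr_support (cls u)"
      then show "(case i of (p1, n1) \<Rightarrow>
          class_bracket (p1, n1) (p + 2 - p1, n + 1 - n1) (cls u (p1, n1)) (cls v (p + 2 - p1, n + 1 - n1)))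
        = (case i of (p1, n1) \<Rightarrow> Y (comp (p1, n1) u) 0
            (comp (p - p1 + 2 * 0 + 2, n - n1 + of_int 0 + 1) v) +o lower (p, n))"
        by (cases i) (simp only: prod.case summand)
    qed
    show ?thesis
      unfolding sum_eq
    proof (rule coset_mode_sum[OF n])
      fix p1 n1 p2 n2 x y
      assume "n1 \<in> half_ints" "n2 \<in> half_ints" "x \<in> bihom (p1, n1)" "x \<in> lower (p1, n1)"
        "y \<in> bihom (p2, n2)"
      then have "Y x 0 y \<in> lower (p1 + p2 - 2, n1 + n2 - 1)"
        by (intro bracket_lower_left)
      then show "Y x 0 y \<in> lower (p1 + p2 - 2 * 0 - 2, n1 + n2 - of_int 0 - 1)"
        by simp
    qed
  qed
  have "gr_bracket (cls u) (cls v) = (\<lambda>(p, n)\<in>bidegs. lower (p, n) + (\<Sum>(p1, n1)\<in>gr_support (cls u).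
      class_bracket (p1, n1) (p + 2 - p1, n + 1 - n1) (cls u (p1, n1)) (cls v (p + 2 - p1, n + 1 - n1))))"
    by (simp add: gr_bracket_def)
  then show ?thesis
    unfolding cls_def[of "Y u 0 v"] using key by (simp only:) (rule restrict_bidegs_eqI, simp)
qed

lemma cls_d: "gr_d (cls u) = cls (d u)"
  unfolding gr_d_def cls_def[of "d u"]
proof (rule restrict_bidegs_eqI, simp only: prod.case)
  fix p n assume n: "n \<in> half_ints"
  then show "class_d (p - 1, n) (cls u (p - 1, n)) = comp (p, n) (d u) +o lower (p, n)"
    using class_d_coset[OF comp_bihom[of "(p - 1, n)" u]] by (simp add: cls_def comp_d)
qed

lemma gr_deg_support: "gr_deg p = {f \<in> carrier gr_algebra. gr_support f \<subseteq> {i. fst i = p}}"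
  by (auto simp: gr_deg_def)

lemma gr_weight_support:
  "gr_weight n = {f \<in> carrier gr_algebra. gr_support f \<subseteq> {i. snd i = n}}"
  by (auto simp: gr_weight_def)

lemma carrier_support_image:
  assumes "\<And>v. v \<in> W \<longleftrightarrow> (\<forall>i\<in>bidegs. comp i v \<noteq> 0 \<longrightarrow> Q i)"
  shows "{f \<in> carrier gr_algebra. gr_support f \<subseteq> {i. Q i}} = cls ` W"
proof (rule Set.set_eqI, rule iffI)
  fix f assume f: "f \<in> {f \<in> carrier gr_algebra. gr_support f \<subseteq> {i. Q i}}"
  then have "f \<in> carrier gr_algebra" by simp
  then obtain v where v: "f = cls v" "\<And>i. i \<in> bidegs \<Longrightarrow> comp i v \<noteq> 0 \<Longrightarrow> i \<in> gr_support f"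
    by (rule carrier_cls) blast
  have "v \<in> W"
    unfolding assms using f v(2) by blast
  then show "f \<in> cls ` W"
    unfolding v(1) by (rule imageI)
next
  fix f assume "f \<in> cls ` W"
  then obtain v where v: "f = cls v" "v \<in> W" by blast
  have "gr_support (cls v) \<subseteq> {i. Q i}"
    using gr_support_cls_subset[of v] v(2)[unfolded assms] by blast
  then show "f \<in> {f \<in> carrier gr_algebra. gr_support f \<subseteq> {i. Q i}}"
    using v(1) cls_carrier by simp
qed

lemma gr_deg_eq: "gr_deg p = cls ` V p"
  unfolding gr_deg_support by (rule carrier_support_image[OF V_iff_comp])

lemma gr_weight_eq: "n \<in> half_ints \<Longrightarrow> gr_weight n = cls ` weight_space \<omega> n"
  unfolding gr_weight_support by (rule carrier_support_image[OF weight_space_iff_comp])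

lemma carrier_eq: "carrier gr_algebra = range cls"
proof -
  have "{f \<in> carrier gr_algebra. gr_support f \<subseteq> {i. True}} = range cls"
    by (rule carrier_support_image) simp
  then show ?thesis by simp
qed

section \<open>The axioms of a Poisson algebra\<close>

lemma product_associative_gr: "Y (Y u (-1) v) (-1) w - Y u (-1) (Y v (-1) w) \<in> gr_kernel"
proof (induction u rule: bihom_induct)
  case u: (bihom p n u)
  show ?case
  proof (induction v rule: bihom_induct)
    case v: (bihom q m v)
    show ?case
    proof (induction w rule: bihom_induct)
      case w: (bihom r k w)
      show ?case
      proof (rule bihom_gr_kernel)
        have "Y (Y u (-1) v) (-1) w \<in> bihom (p + q + r, n + m + k)"
          using mode_bihom[OF mode_bihom[OF u(2) v(2), of "-1"] w(2), of "-1"] by simp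
        moreover have "Y u (-1) (Y v (-1) w) \<in> bihom (p + q + r, n + m + k)"
          using mode_bihom[OF u(2) mode_bihom[OF v(2) w(2), of "-1"], of "-1"]
          by (simp add: add.assoc)
        ultimately show "Y (Y u (-1) v) (-1) w - Y u (-1) (Y v (-1) w) \<in> bihom (p + q + r, n + m + k)"
          by (rule subspace_diff[OF bihom_subspace])
        show "Y (Y u (-1) v) (-1) w - Y u (-1) (Y v (-1) w) \<in> lower (p + q + r, n + m + k)"
          by (rule product_associative[OF u(2) v(2) w(2) u(1) v(1) w(1)])
        show "n + m + k \<in> half_ints"
          using u v w by simp
      qed
    next
      case (add w w')
      from subspace_add[OF gr_kernel_subspace this] show ?case
        by (simp add: Y_simps add_diff_add)
    qed (simp add: Y_simps subspace_0[OF gr_kernel_subspace])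
  next
    case (add v v')
    from subspace_add[OF gr_kernel_subspace this] show ?case
      by (simp add: Y_simps add_diff_add)
  qed (simp add: Y_simps subspace_0[OF gr_kernel_subspace])
next
  case (add u u')
  from subspace_add[OF gr_kernel_subspace this] show ?case
    by (simp add: Y_simps add_diff_add)
qed (simp add: Y_simps subspace_0[OF gr_kernel_subspace])

text \<open>The scalar \<open>z\<close> is the sign of the two degrees, which are fixed; so the statement is bilinear and follows
  from the case of bihomogeneous vectors.\<close>

lemma swap_mem_gr_kernel:
  assumes "u \<in> V p" and "v \<in> V q"
    and "\<And>n m u v. n \<in> half_ints \<Longrightarrow> m \<in> half_ints \<Longrightarrow> u \<in> bihom (p, n) \<Longrightarrow> v \<in> bihom (q, m)
      \<Longrightarrow> Y u k v - z *\<^sub>C Y v k u \<in> lower (p + q - 2 * k - 2, n + m - of_int k - 1)"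
  shows "Y u k v - z *\<^sub>C Y v k u \<in> gr_kernel"
  using assms(1)
proof (induction u rule: V_bihom_induct)
  case u: (bihom n u)
  show ?case
    using assms(2)
  proof (induction v rule: V_bihom_induct)
    case v: (bihom m v)
    show ?case
    proof (rule bihom_gr_kernel)
      have "Y v k u \<in> bihom (p + q - 2 * k - 2, n + m - of_int k - 1)"
        using mode_bihom[OF v(2) u(2), of k] by (simp add: add.commute)
      then show "Y u k v - z *\<^sub>C Y v k u \<in> bihom (p + q - 2 * k - 2, n + m - of_int k - 1)"
        using mode_bihom[OF u(2) v(2), of k]
        by (intro subspace_diff[OF bihom_subspace] subspace_scale[OF bihom_subspace])
      show "Y u k v - z *\<^sub>C Y v k u \<in> lower (p + q - 2 * k - 2, n + m - of_int k - 1)"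
        using assms(3) u v by blast
      show "n + m - of_int k - 1 \<in> half_ints"
        using u v by simp
    qed
  next
    case (add v v')
    from subspace_add[OF gr_kernel_subspace this] show ?case
      by (simp add: Y_simps scale_right_distrib add_diff_add)
  qed (simp add: Y_simps subspace_0[OF gr_kernel_subspace])
next
  case (add u u')
  from subspace_add[OF gr_kernel_subspace this] show ?case
    by (simp add: Y_simps scale_right_distrib add_diff_add)
qed (simp add: Y_simps subspace_0[OF gr_kernel_subspace])

lemma product_commutative_gr:
  assumes "u \<in> V p" and "v \<in> V q"
  shows "Y u (-1) v - ((-1) powi (p * q)) *\<^sub>C Y v (-1) u \<in> gr_kernel"
proof (rule swap_mem_gr_kernel[OF assms])
  fix n m u v
  assume "n \<in> half_ints" "m \<in> half_ints" "u \<in> bihom (p, n)" "v \<in> bihom (q, m)"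
  then have "Y u (-1) v - ((-1) powi (q * p)) *\<^sub>C Y v (-1) u \<in> lower (q + p, m + n)"
    by (intro product_commutative)
  then show "Y u (-1) v - ((-1) powi (p * q)) *\<^sub>C Y v (-1) u
      \<in> lower (p + q - 2 * (-1) - 2, n + m - of_int (-1) - 1)"
    by (simp add: add.commute mult.commute)
qed

lemma bracket_antisymmetric_gr:
  assumes "u \<in> V p" and "v \<in> V q"
  shows "Y u 0 v - (- ((-1) powi (p * q))) *\<^sub>C Y v 0 u \<in> gr_kernel"
proof (rule swap_mem_gr_kernel[OF assms])
  fix n m u v
  assume "n \<in> half_ints" "m \<in> half_ints" "u \<in> bihom (p, n)" "v \<in> bihom (q, m)"
  then have "Y u 0 v + ((-1) powi (q * p)) *\<^sub>C Y v 0 u \<in> lower (q + p - 2, m + n - 1)"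
    by (intro skew_bracket)
  then show "Y u 0 v - (- ((-1) powi (p * q))) *\<^sub>C Y v 0 u
      \<in> lower (p + q - 2 * 0 - 2, n + m - of_int 0 - 1)"
    by (simp add: add.commute mult.commute)
qed

lemma carrierE: "f \<in> carrier gr_algebra \<Longrightarrow> (\<And>v. f = cls v \<Longrightarrow> P) \<Longrightarrow> P"
  by (auto simp: carrier_eq)

lemma degE: "f \<in> gr_deg p \<Longrightarrow> (\<And>v. f = cls v \<Longrightarrow> v \<in> V p \<Longrightarrow> P) \<Longrightarrow> P"
  by (auto simp: gr_deg_eq)

lemmas cls_simps = cls_zero cls_one cls_add cls_smult cls_mult cls_bracket cls_d cls_carrier

lemma gr_abelian_group: "abelian_group gr_algebra"
proof (rule abelian_groupI)
  fix x assume "x \<in> carrier gr_algebra"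
  then show "\<exists>y\<in>carrier gr_algebra. y \<oplus>\<^bsub>gr_algebra\<^esub> x = \<zero>\<^bsub>gr_algebra\<^esub>"
  proof (rule carrierE)
    fix v assume "x = cls v"
    then show ?thesis
      by (intro bexI[of _ "cls (- v)"]) (simp_all add: cls_simps)
  qed
qed (auto elim!: carrierE simp: cls_simps ac_simps)

lemma gr_minus: "\<ominus>\<^bsub>gr_algebra\<^esub> cls v = cls (- v)"
  by (rule abelian_group.minus_equality[OF gr_abelian_group]) (simp_all add: cls_simps)

lemma gr_ring: "ring gr_algebra"
proof (rule ringI[OF gr_abelian_group])
  show "monoid gr_algebra"
    by (rule monoidI)
      (auto elim!: carrierE simp: cls_simps Y_vac creation cls_eq_iff product_associative_gr)
qed (auto elim!: carrierE simp: cls_simps Y_simps)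

lemma gr_module: "Module.module complex_field gr_algebra"
  by (rule moduleI[OF cring_complex_field gr_abelian_group])
    (auto elim!: carrierE simp: cls_simps scale_left_distrib scale_right_distrib)

lemma submodule_cls_image:
  assumes "subspace W"
  shows "submodule (cls ` W) complex_field gr_algebra"
  using assms by (intro module.submoduleI[OF gr_module])
    (auto simp: cls_simps gr_minus intro!: imageI
      intro: subspace_0 subspace_add subspace_scale subspace_neg)

lemma gr_zero_apply: "i \<in> bidegs \<Longrightarrow> \<zero>\<^bsub>gr_algebra\<^esub> i = lower i"
  by (simp add: gr_algebra_def)

lemma carrier_restrict:
  assumes "f \<in> carrier gr_algebra"
  shows "(\<lambda>i\<in>bidegs. if Q i then f i else lower i) \<in> carrier gr_algebra"
    and "gr_support (\<lambda>i\<in>bidegs. if Q i then f i else lower i) = gr_support f \<inter> {i. Q i}"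
proof -
  show supp: "gr_support (\<lambda>i\<in>bidegs. if Q i then f i else lower i) = gr_support f \<inter> {i. Q i}"
    by (auto simp: gr_support_def split: if_splits)
  have "lower i \<in> gr_component i" for i
    using subspace_0[OF bihom_subspace, of i] by (force simp: gr_component_def)
  then show "(\<lambda>i\<in>bidegs. if Q i then f i else lower i) \<in> carrier gr_algebra"
    using assms supp by (auto simp: gr_algebra_def)
qed

lemma carrier_eqI:
  assumes "f \<in> carrier gr_algebra" and "g \<in> carrier gr_algebra"
    and "\<And>i. i \<in> bidegs \<Longrightarrow> f i = g i"
  shows "f = g"
  using assms by (intro PiE_ext[of f bidegs gr_component g]) (auto simp: gr_algebra_def)

text \<open>At each bidegree \<open>i\<close> only the summand \<open>\<tau> i\<close> can differ from the zero coset.\<close>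

lemma finsum_disjoint_support:
  assumes "finite J" and "\<And>j. j \<in> J \<Longrightarrow> F j \<in> carrier gr_algebra"
    and "\<And>j. j \<in> J \<Longrightarrow> gr_support (F j) \<subseteq> {i. \<tau> i = j}" and "i \<in> bidegs"
  shows "(\<Oplus>\<^bsub>gr_algebra\<^esub>j\<in>J. F j) i = (if \<tau> i \<in> J then F (\<tau> i) i else lower i)"
  using assms(1-3)
proof (induction J rule: finite_induct)
  case empty
  interpret abelian_group gr_algebra by (rule gr_abelian_group)
  show ?case using assms(4) by (simp add: gr_zero_apply)
next
  case (insert j J)
  interpret abelian_group gr_algebra by (rule gr_abelian_group)
  have add: "(f \<oplus>\<^bsub>gr_algebra\<^esub> g) i = f i + g i" for f g
    using assms(4) by (simp add: gr_algebra_def)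
  have outside: "F k i = lower i" if "k \<in> insert j J" "\<tau> i \<noteq> k" for k
    using insert.prems(2)[OF that(1)] that(2) assms(4) by (auto simp: gr_support_def)
  have absorb: "lower i + F k i = F k i" "F k i + lower i = F k i" if k: "k \<in> insert j J" for k
  proof -
    obtain v where "F k = cls v"
      using insert.prems(1)[OF k] by (rule carrierE)
    then have e: "F k i = comp i v +o lower i"
      using assms(4) by (simp add: cls_def)
    show "lower i + F k i = F k i"
      unfolding e by (rule subspace_add_coset[OF lower_subspace])
    then show "F k i + lower i = F k i"
      by (simp only: add.commute)
  qed
  have "(\<Oplus>\<^bsub>gr_algebra\<^esub>k\<in>insert j J. F k) = F j \<oplus>\<^bsub>gr_algebra\<^esub> (\<Oplus>\<^bsub>gr_algebra\<^esub>k\<in>J. F k)"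
    using insert by (intro finsum_insert) auto
  moreover have "(\<Oplus>\<^bsub>gr_algebra\<^esub>k\<in>J. F k) i = (if \<tau> i \<in> J then F (\<tau> i) i else lower i)"
    using insert by blast
  ultimately have sum: "(\<Oplus>\<^bsub>gr_algebra\<^esub>k\<in>insert j J. F k) i
      = F j i + (if \<tau> i \<in> J then F (\<tau> i) i else lower i)"
    by (simp only: add)
  show ?case
  proof (cases "\<tau> i = j")
    case True
    then show ?thesis
      using insert.hyps(2) absorb(2)[of j] by (simp add: sum)
  next
    case False
    then show ?thesis
      using outside[of j] absorb(1)[of "\<tau> i"] subspace_plus_self[OF lower_subspace, of i]
      by (auto simp: sum)
  qed
qed

text \<open>Grading the families supported in \<open>S\<close> by a function \<open>\<tau>\<close> of the bidegree. With \<open>\<tau> = fst\<close> and \<open>\<tau> = snd\<close> these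
  are the gradings by degree and by weight, and with \<open>\<tau> = fst\<close> and \<open>S\<close> the bidegrees of one weight it is
  the grading of a weight space by degree. The components of a family are its restrictions to the fibres of
  \<open>\<tau>\<close>.\<close>

lemma gr_carrier_direct_sum:
  assumes "\<And>i. i \<in> bidegs \<Longrightarrow> i \<in> S \<Longrightarrow> \<tau> i \<in> I"
  shows "carrier_direct_sum gr_algebra {f \<in> carrier gr_algebra. gr_support f \<subseteq> S} I
    (\<lambda>j. {f \<in> carrier gr_algebra. gr_support f \<subseteq> S \<inter> {i. \<tau> i = j}})"
    (is "carrier_direct_sum _ ?M I ?W")
  unfolding carrier_direct_sum_def
proof (intro conjI ballI)
  show "?W j \<subseteq> ?M" for j by auto
  fix x assume x: "x \<in> ?M"
  interpret abelian_group gr_algebra by (rule gr_abelian_group)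
  let ?supp = "\<lambda>F. {j \<in> I. F j \<noteq> \<zero>\<^bsub>gr_algebra\<^esub>}"
  let ?P = "\<lambda>F. F \<in> Pi\<^sub>E I ?W \<and> finite (?supp F) \<and> x = (\<Oplus>\<^bsub>gr_algebra\<^esub>j\<in>?supp F. F j)"
  note zero = gr_zero_apply
  have finsum_at: "(\<Oplus>\<^bsub>gr_algebra\<^esub>j\<in>?supp F. F j) i = (if \<tau> i \<in> I then F (\<tau> i) i else lower i)"
    if "F \<in> Pi\<^sub>E I ?W" "finite (?supp F)" "i \<in> bidegs" for F i
    using finsum_disjoint_support[of "?supp F" F \<tau> i] that zero[OF that(3)] by (auto simp: PiE_iff)
  define F where "F = (\<lambda>j\<in>I. \<lambda>i\<in>bidegs. if \<tau> i = j then x i else lower i)"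
  have F: "F \<in> Pi\<^sub>E I ?W"
    unfolding F_def restrict_PiE_iff
  proof
    fix j assume "j \<in> I"
    show "(\<lambda>i\<in>bidegs. if \<tau> i = j then x i else lower i) \<in> ?W j"
      using x carrier_restrict[of x "\<lambda>i. \<tau> i = j"] by auto
  qed
  have "?supp F \<subseteq> \<tau> ` gr_support x"
  proof
    fix j assume j: "j \<in> ?supp F"
    then have "gr_support (F j) \<noteq> {}"
      using F carrier_eqI[of "F j" "\<zero>\<^bsub>gr_algebra\<^esub>"] zero by (auto simp: gr_support_def PiE_iff)
    then show "j \<in> \<tau> ` gr_support x"
      using j x carrier_restrict(2)[of x "\<lambda>i. \<tau> i = j"] by (auto simp: F_def)
  qed
  then have fin: "finite (?supp F)"
    using x by (auto simp: gr_algebra_def intro: finite_subset)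
  have "x = (\<Oplus>\<^bsub>gr_algebra\<^esub>j\<in>?supp F. F j)"
  proof (rule carrier_eqI)
    show "(\<Oplus>\<^bsub>gr_algebra\<^esub>j\<in>?supp F. F j) \<in> carrier gr_algebra"
      using F by (intro finsum_closed) (auto simp: PiE_iff)
    fix i assume i: "i \<in> bidegs"
    show "x i = (\<Oplus>\<^bsub>gr_algebra\<^esub>j\<in>?supp F. F j) i"
      unfolding finsum_at[OF F fin i] using i x assms[OF i] by (auto simp: F_def gr_support_def)
  qed (use x in simp)
  then have "?P F" using F fin by blast
  moreover have "G = F" if G: "?P G" for G
  proof (rule PiE_ext[of G I ?W F])
    show "G \<in> Pi\<^sub>E I ?W" "F \<in> Pi\<^sub>E I ?W" using G F by auto
    fix j assume j: "j \<in> I"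
    show "G j = F j"
    proof (rule carrier_eqI)
      show "G j \<in> carrier gr_algebra" "F j \<in> carrier gr_algebra"
        using G F j by (auto simp: PiE_iff)
      fix i assume i: "i \<in> bidegs"
      show "G j i = F j i"
      proof (cases "\<tau> i = j")
        case True
        have "x i = G j i"
          using G finsum_at[of G i] i j True by auto
        then show ?thesis
          using True i j by (simp add: F_def)
      next
        case False
        have "gr_support (G j) \<subseteq> {i. \<tau> i = j}"
          using G j by (auto simp: PiE_iff)
        then have "G j i = lower i"
          using False i by (auto simp: gr_support_def)
        then show ?thesis
          using False i j by (simp add: F_def)
      qed
    qed
  qed
  ultimately show "\<exists>!F. ?P F" by blast
qed

lemma gr_complex_algebra: "complex_algebra gr_algebra"
proof (intro complex_algebra.intro complex_algebra_axioms.intro gr_ring gr_module)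
  fix a b z assume "a \<in> carrier gr_algebra" "b \<in> carrier gr_algebra"
  then obtain u v where "a = cls u" "b = cls v"
    by (auto elim!: carrierE)
  then show "(z \<odot>\<^bsub>gr_algebra\<^esub> a) \<otimes>\<^bsub>gr_algebra\<^esub> b
      = z \<odot>\<^bsub>gr_algebra\<^esub> (a \<otimes>\<^bsub>gr_algebra\<^esub> b)"
    and "a \<otimes>\<^bsub>gr_algebra\<^esub> (z \<odot>\<^bsub>gr_algebra\<^esub> b)
      = z \<odot>\<^bsub>gr_algebra\<^esub> (a \<otimes>\<^bsub>gr_algebra\<^esub> b)"
    by (simp_all add: cls_simps Y_simps)
qed

lemma gr_dg_algebra: "dg_algebra gr_algebra gr_deg gr_d"
proof (intro dg_algebra.intro dg_algebra_axioms.intro gr_complex_algebra)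
  show "submodule (gr_deg p) complex_field gr_algebra" for p
    unfolding gr_deg_eq by (rule submodule_cls_image[OF V_subspace])
  show "carrier_direct_sum gr_algebra (carrier gr_algebra) UNIV gr_deg"
    using gr_carrier_direct_sum[of UNIV fst UNIV] by (simp add: gr_deg_support[abs_def])
  show "\<one>\<^bsub>gr_algebra\<^esub> \<in> gr_deg 0"
    by (auto simp: gr_deg_eq cls_simps vac_deg)
  fix a b z
  show "a \<otimes>\<^bsub>gr_algebra\<^esub> b \<in> gr_deg (p + q)" if "a \<in> gr_deg p" "b \<in> gr_deg q" for p q
    using that Y_deg[of _ p _ q "-1"]
    by (auto elim!: degE simp: cls_simps add.commute) (auto simp: gr_deg_eq)
  show "gr_d a \<in> gr_deg (p + 1)" if "a \<in> gr_deg p" for p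
    using that d_deg by (auto elim!: degE simp: cls_simps) (auto simp: gr_deg_eq)
  show "gr_d (a \<otimes>\<^bsub>gr_algebra\<^esub> b) = gr_d a \<otimes>\<^bsub>gr_algebra\<^esub> b
      \<oplus>\<^bsub>gr_algebra\<^esub> ((-1) powi p) \<odot>\<^bsub>gr_algebra\<^esub> (a \<otimes>\<^bsub>gr_algebra\<^esub> gr_d b)"
    if "a \<in> gr_deg p" "b \<in> gr_deg q" for p q
    using that by (auto elim!: degE simp: cls_simps Y_d)
  assume a: "a \<in> carrier gr_algebra"
  show "gr_d a \<in> carrier gr_algebra"
    and "gr_d (z \<odot>\<^bsub>gr_algebra\<^esub> a) = z \<odot>\<^bsub>gr_algebra\<^esub> gr_d a"
    and "gr_d (gr_d a) = \<zero>\<^bsub>gr_algebra\<^esub>"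
    using a by (auto elim!: carrierE simp: cls_simps d_simps d_d)
  show "gr_d (a \<oplus>\<^bsub>gr_algebra\<^esub> b) = gr_d a \<oplus>\<^bsub>gr_algebra\<^esub> gr_d b"
    if "b \<in> carrier gr_algebra"
    using a that by (auto elim!: carrierE simp: cls_simps d_simps)
qed

lemma gr_dg_poisson_algebra: "dg_poisson_algebra gr_algebra gr_deg gr_d gr_bracket (-2)"
proof (intro dg_poisson_algebra.intro dg_poisson_algebra_axioms.intro gr_dg_algebra)
  fix a b c z
  show "gr_bracket a b \<in> gr_deg (p + q + - 2)" if "a \<in> gr_deg p" "b \<in> gr_deg q" for p q
    using that Y_deg[of _ p _ q 0]
    by (auto elim!: degE simp: cls_simps) (auto simp: gr_deg_eq algebra_simps)
  show "gr_bracket a b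
      = \<ominus>\<^bsub>gr_algebra\<^esub> (((-1) powi (p * q)) \<odot>\<^bsub>gr_algebra\<^esub> gr_bracket b a)"
    if "a \<in> gr_deg p" "b \<in> gr_deg q" for p q
    using that bracket_antisymmetric_gr[of _ p _ q]
    by (auto elim!: degE simp: cls_simps gr_minus cls_eq_iff)
  show "gr_bracket a (gr_bracket b c) = gr_bracket (gr_bracket a b) c
      \<oplus>\<^bsub>gr_algebra\<^esub> ((-1) powi (p * q)) \<odot>\<^bsub>gr_algebra\<^esub> gr_bracket b (gr_bracket a c)"
    and "gr_bracket a (b \<otimes>\<^bsub>gr_algebra\<^esub> c) = gr_bracket a b \<otimes>\<^bsub>gr_algebra\<^esub> c
      \<oplus>\<^bsub>gr_algebra\<^esub> ((-1) powi (p * q)) \<odot>\<^bsub>gr_algebra\<^esub> (b \<otimes>\<^bsub>gr_algebra\<^esub> gr_bracket a c)"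
    if "a \<in> gr_deg p" "b \<in> gr_deg q" "c \<in> gr_deg r" for p q r
  proof -
    note abc_deg = that
    obtain u v w where abc: "a = cls u" "b = cls v" "c = cls w" and uv: "u \<in> V p" "v \<in> V q"
      using abc_deg by (auto elim!: degE)
    note derivation = zero_mode_derivation[OF uv, of _ w]
    show "gr_bracket a (gr_bracket b c) = gr_bracket (gr_bracket a b) c
        \<oplus>\<^bsub>gr_algebra\<^esub> ((-1) powi (p * q)) \<odot>\<^bsub>gr_algebra\<^esub> gr_bracket b (gr_bracket a c)"
      and "gr_bracket a (b \<otimes>\<^bsub>gr_algebra\<^esub> c) = gr_bracket a b \<otimes>\<^bsub>gr_algebra\<^esub> c
        \<oplus>\<^bsub>gr_algebra\<^esub> ((-1) powi (p * q)) \<odot>\<^bsub>gr_algebra\<^esub> (b \<otimes>\<^bsub>gr_algebra\<^esub> gr_bracket a c)"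
      unfolding abc cls_simps by (simp_all only: derivation)
  qed
  show "gr_d (gr_bracket a b) = gr_bracket (gr_d a) b
      \<oplus>\<^bsub>gr_algebra\<^esub> ((-1) powi p) \<odot>\<^bsub>gr_algebra\<^esub> gr_bracket a (gr_d b)"
    if "a \<in> gr_deg p" "b \<in> gr_deg q" for p q
    using that by (auto elim!: degE simp: cls_simps Y_d)
  assume ab: "a \<in> carrier gr_algebra" "b \<in> carrier gr_algebra"
  show "gr_bracket a b \<in> carrier gr_algebra"
    and "gr_bracket (z \<odot>\<^bsub>gr_algebra\<^esub> a) b = z \<odot>\<^bsub>gr_algebra\<^esub> gr_bracket a b"
    and "gr_bracket a (z \<odot>\<^bsub>gr_algebra\<^esub> b) = z \<odot>\<^bsub>gr_algebra\<^esub> gr_bracket a b"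
    using ab by (auto elim!: carrierE simp: cls_simps Y_simps)
  assume c: "c \<in> carrier gr_algebra"
  show "gr_bracket (a \<oplus>\<^bsub>gr_algebra\<^esub> b) c
      = gr_bracket a c \<oplus>\<^bsub>gr_algebra\<^esub> gr_bracket b c"
    and "gr_bracket a (b \<oplus>\<^bsub>gr_algebra\<^esub> c)
      = gr_bracket a b \<oplus>\<^bsub>gr_algebra\<^esub> gr_bracket a c"
    using ab c by (auto elim!: carrierE simp: cls_simps Y_simps)
qed simp

lemma weightE:
  "f \<in> gr_weight n \<Longrightarrow> n \<in> half_ints \<Longrightarrow> (\<And>v. f = cls v \<Longrightarrow> v \<in> weight_space \<omega> n \<Longrightarrow> P) \<Longrightarrow> P"
  by (auto simp: gr_weight_eq)

lemma cls_gr_weight: "v \<in> weight_space \<omega> n \<Longrightarrow> n \<in> half_ints \<Longrightarrow> cls v \<in> gr_weight n"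
  by (auto simp: gr_weight_eq)

lemma gr_weight_graded_dg_poisson_algebra:
  "weight_graded_dg_poisson_algebra gr_algebra gr_deg gr_d gr_bracket (-2) gr_weight (-1)"
proof (intro weight_graded_dg_poisson_algebra.intro weight_graded_dg_poisson_algebra_axioms.intro
    gr_dg_poisson_algebra)
  show "(-1 :: real) \<in> half_ints"
    using half_ints_closed(3)[of "-1"] by simp
  show "carrier_direct_sum gr_algebra (carrier gr_algebra) half_ints gr_weight"
    using gr_carrier_direct_sum[of UNIV snd half_ints]
    by (auto simp: gr_weight_support[abs_def])
  show "\<one>\<^bsub>gr_algebra\<^esub> \<in> gr_weight 0"
    by (simp add: cls_simps cls_gr_weight vac_weight)
  fix n assume n: "n \<in> half_ints"
  show "submodule (gr_weight n) complex_field gr_algebra"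
    unfolding gr_weight_eq[OF n] by (rule submodule_cls_image[OF weight_space_subspace])
  show "carrier_direct_sum gr_algebra (gr_weight n) UNIV (\<lambda>p. gr_weight n \<inter> gr_deg p)"
  proof -
    have "gr_weight n \<inter> gr_deg p
        = {f \<in> carrier gr_algebra. gr_support f \<subseteq> {i. snd i = n} \<inter> {i. fst i = p}}" for p
      by (auto simp: gr_weight_support gr_deg_support)
    then show ?thesis
      using gr_carrier_direct_sum[of "{i. snd i = n}" fst UNIV] by (simp add: gr_weight_support)
  qed
  show "gr_d a \<in> gr_weight n" if "a \<in> gr_weight n" for a
    using that n by (auto elim!: weightE simp: cls_simps intro!: cls_gr_weight d_weight)
  fix m a b assume m: "m \<in> half_ints" and a: "a \<in> gr_weight m" and b: "b \<in> gr_weight n"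
  obtain u v where uv: "a = cls u" "u \<in> weight_space \<omega> m" "b = cls v" "v \<in> weight_space \<omega> n"
    using a b m n by (auto elim!: weightE)
  show "a \<otimes>\<^bsub>gr_algebra\<^esub> b \<in> gr_weight (m + n)"
    using cls_gr_weight[OF mode_weight[OF uv(2,4), of "-1"]] m n by (simp add: uv cls_simps)
  show "gr_bracket a b \<in> gr_weight (m + n + - 1)"
    using cls_gr_weight[OF mode_weight[OF uv(2,4), of 0]] m n by (simp add: uv cls_simps)
qed

lemma gr_graded_commutative: "graded_commutative gr_algebra gr_deg"
  unfolding graded_commutative_def
  by (auto elim!: degE simp: cls_simps cls_eq_iff product_commutative_gr)

end

theorem proposition6p16:
  fixes scale :: "complex \<Rightarrow> 'v::ab_group_add \<Rightarrow> 'v"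
    and V :: "int \<Rightarrow> 'v set"
    and d :: "'v \<Rightarrow> 'v"
    and Y :: "'v \<Rightarrow> int \<Rightarrow> 'v \<Rightarrow> 'v"
    and vac \<omega> :: 'v
  assumes "dg_vertex_operator_algebra scale V d Y vac \<omega>"
  defines "A \<equiv> dg_vertex_operator_algebra.gr_algebra scale V Y vac \<omega>"
    and "deg \<equiv> dg_vertex_operator_algebra.gr_deg scale V Y vac \<omega>"
    and "weight \<equiv> dg_vertex_operator_algebra.gr_weight scale V Y vac \<omega>"
    and "D \<equiv> dg_vertex_operator_algebra.gr_d scale V d Y \<omega>"
    and "bracket \<equiv> dg_vertex_operator_algebra.gr_bracket scale V Y \<omega>"
  shows "weight_graded_dg_poisson_algebra A deg D bracket (-2) weight (-1)
    \<and> graded_commutative A deg"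
proof -
  interpret dg_vertex_operator_algebra scale V d Y vac \<omega>
    by (rule assms(1))
  show ?thesis
    unfolding A_def deg_def weight_def D_def bracket_def
    using gr_weight_graded_dg_poisson_algebra gr_graded_commutative by (rule conjI)
qed

end
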